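(* Sorting a sequence of $n$ distinct elements has deterministic fragile complexity $\Theta(\log(\mathrm{Inv}))$: there is a deterministic comparison-based sorting algorithm in which every element participates in $O(\log(\mathrm{Inv}))$ comparisons, where $\mathrm{Inv}$ is the number of inversions of the input, and for every $k$ there are inputs with $\mathrm{Inv}\le k$ on which any deterministic comparison-based sorting algorithm forces some element to participate in $\Omega(\log k)$ comparisons.
   Context: An inversion of a sequence $a_1,\dots,a_n$ is a pair of indices $i<j$ with $a_i>a_j$; $\mathrm{Inv}$ is the total number of inversions in the input. An element participates in a comparison if it is one of the two elements compared. Logarithms of a parameter $r$ are understood as $\log\max(r,2)$. *)

theory Defs
  imports Complex_Main
begin

text \<open>Deterministic comparison-based algorithms on n inputs are modelled as
comparison decision trees. An input is a function a from indices {..<n} to a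
linear order (here nat; only the relative order matters). A node Cmp i j l r
compares a i with a j and continues in l if a i < a j and in r otherwise.
A leaf returns the output as a list of input indices (the sorted order).\<close>

datatype dtree = Out "nat list" | Cmp nat nat dtree dtree

fun run :: "dtree \<Rightarrow> (nat \<Rightarrow> nat) \<Rightarrow> nat list" where
  "run (Out xs) a = xs"
| "run (Cmp i j l r) a = (if a i < a j then run l a else run r a)"

fun comps :: "dtree \<Rightarrow> (nat \<Rightarrow> nat) \<Rightarrow> (nat \<times> nat) list" where
  "comps (Out xs) a = []"
| "comps (Cmp i j l r) a = (i, j) # (if a i < a j then comps l a else comps r a)"

definition participations :: "dtree \<Rightarrow> (nat \<Rightarrow> nat) \<Rightarrow> nat \<Rightarrow> nat" where
  "participations T a i = length (filter (\<lambda>(x, y). x = i \<or> y = i) (comps T a))"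

fun indices_ok :: "nat \<Rightarrow> dtree \<Rightarrow> bool" where
  "indices_ok n (Out xs) = True"
| "indices_ok n (Cmp i j l r) = (i < n \<and> j < n \<and> indices_ok n l \<and> indices_ok n r)"

definition sorts :: "nat \<Rightarrow> dtree \<Rightarrow> bool" where
  "sorts n T \<longleftrightarrow> indices_ok n T \<and>
     (\<forall>a. inj_on a {..<n} \<longrightarrow>
        (distinct (run T a) \<and> set (run T a) = {..<n} \<and> sorted (map a (run T a))))"

definition Inv :: "nat \<Rightarrow> (nat \<Rightarrow> nat) \<Rightarrow> nat" where
  "Inv n a = card {(i, j). i < j \<and> j < n \<and> a i > a j}"

definition lg :: "nat \<Rightarrow> real" where
  "lg r = log 2 (real (max r 2))"

end

theory Submission
  imports Defs "HOL-Library.Disjoint_Sets"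
begin

text \<open>Upper bound. A set is sorted by a quicksort whose partition step multiplies the total weight
\<open>\<Sum>x. b ^ f x\<close> by at most 2, where f x counts the comparisons of x; over logarithmically many levels
this bounds every f x by O(log n). To partition Z, cut it into groups of constant size, sort them, and
choose the lightest element of each subblock as a representative. The representatives have so small a
share of the weight that they can be split recursively, many times over, into buckets; this locates
all but a few elements of Z in one of many classes. The remaining ones are compared with distinct
elements of each class, and the recursion continues in a zone carrying at most a tenth of the weight.

Adaptivity. For a guess H of the number of inversions, two rounds of sorting blocks of O(H) elements
fix the order of every input with at most H inversions; comparing adjacent elements then verifies the
guess. Trying H = 2 ^ (2 ^ i) for i = 0, 1, ... costs a geometric sum.

Lower bound. Inserting one element at any of k + 1 ranks costs at most k inversions, and the
comparisons of that element alone have to distinguish all k + 1 outputs.\<close>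

section \<open>Comparison games\<close>

text \<open>A pivot compared with everybody would alone pay linearly much, and even in a balanced
  partition scheme a few elements have to pay more than the others. The weight makes it possible to
  load this work on elements that have paid little so far. The partition works because its factor 2
  reproduces itself: the recursive calls may double the weight of the sets they are applied to, but
  these sets carry so small a share of the total weight that, for \<open>b\<close> close enough to
  1, the whole step stays within a factor 2 again. This is why balance (an eighth on each side) and
  most size estimates can afford to be crude, and why the constants are so large. In the adaptive
  part the number of inversions is unknown. A guess H costs only O(log H) to test, and squaring the
  guess doubles this price, so that the last test dominates.\<close>

text \<open>Adaptive strategies are built as winning strategies against an adversary. A position is a set
A of inputs, those consistent with all answers so far, together with the number f x of comparisons
every element x has taken part in; what is known about the order is what holds for all of A.
Inconsistent answers end the game: this is the rule for the empty set.\<close>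

inductive win :: "nat \<Rightarrow> ((nat \<Rightarrow> nat) set \<Rightarrow> (nat \<Rightarrow> nat) \<Rightarrow> bool) \<Rightarrow> (nat \<Rightarrow> nat) set \<Rightarrow> (nat \<Rightarrow> nat) \<Rightarrow> bool"
  for n :: nat and G :: "(nat \<Rightarrow> nat) set \<Rightarrow> (nat \<Rightarrow> nat) \<Rightarrow> bool" where
  win_empty: "win n G {} f"
| win_done: "G A f \<Longrightarrow> win n G A f"
| win_cmp: "\<lbrakk>i < n; j < n; i \<noteq> j;
    win n G {a \<in> A. a i < a j} (f(i := Suc (f i), j := Suc (f j)));
    win n G {a \<in> A. a j < a i} (f(i := Suc (f i), j := Suc (f j)))\<rbrakk> \<Longrightarrow> win n G A f"

text \<open>Sequential composition. The continuation has to deal with nonempty \<open>A'\<close>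
  only, because an empty position is won outright; actual orders can be extracted from
  \<open>decided\<close> only in nonempty positions.\<close>

lemma win_bind:
  assumes "win n G A f"
    and "\<And>A' f'. G A' f' \<Longrightarrow> A' \<subseteq> A \<Longrightarrow> A' \<noteq> {} \<Longrightarrow> win n H A' f'"
  shows "win n H A f"
  using assms
proof (induction A f rule: win.induct)
  case (win_empty f)
  show ?case by (rule win.win_empty)
next
  case (win_done A f)
  then show ?case by (cases "A = {}") (auto intro: win.win_empty)
next
  case (win_cmp i j A f)
  show ?case
  proof (rule win.win_cmp[OF win_cmp.hyps(1-3)])
    show "win n H {a \<in> A. a i < a j} (f(i := Suc (f i), j := Suc (f j)))"
      by (rule win_cmp.IH(1)) (auto intro!: win_cmp.prems)
    show "win n H {a \<in> A. a j < a i} (f(i := Suc (f i), j := Suc (f j)))"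
      by (rule win_cmp.IH(2)) (auto intro!: win_cmp.prems)
  qed
qed

lemma win_mono:
  assumes "win n G A f"
    and "\<And>A' f'. G A' f' \<Longrightarrow> A' \<subseteq> A \<Longrightarrow> A' \<noteq> {} \<Longrightarrow> H A' f'"
  shows "win n H A f"
  using assms by (blast intro: win_bind win_done)

text \<open>The rules never read the counts, so a strategy can be replayed on top of any earlier
  counts. A phase can thus be analysed as if it started at zero.\<close>

lemma win_shift:
  assumes "win n G A f"
  shows "win n (\<lambda>A' f'. \<exists>f''. G A' f'' \<and> (\<forall>x. f' x = f'' x + h x)) A (\<lambda>x. f x + h x)"
  using assms
proof (induction A f rule: win.induct)
  case (win_empty f)
  show ?case by (rule win.win_empty)
next
  case (win_done A f)
  then show ?case by (intro win.win_done) auto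
next
  case (win_cmp i j A f)
  have eq: "(\<lambda>x. (f(i := Suc (f i), j := Suc (f j))) x + h x) =
     (\<lambda>x. f x + h x)(i := Suc (f i + h i), j := Suc (f j + h j))"
    by auto
  show ?case
    by (rule win.win_cmp[OF win_cmp.hyps(1-3)]) (use win_cmp.IH eq in auto)
qed

text \<open>Both branches of \<open>win_cmp\<close> use a strict order, so an input with a tie would
  fall out of both; hence the injectivity. The output may be any function \<open>out\<close> of the
  final position.\<close>

lemma win_imp_dtree:
  assumes "win n G A f" and "\<And>a. a \<in> A \<Longrightarrow> inj_on a {..<n}"
  shows "\<exists>T. indices_ok n T \<and> (\<forall>a\<in>A. \<exists>A' f'. G A' f' \<and> a \<in> A' \<and> run T a = out A' f' \<and>
           (\<forall>x. f' x = f x + participations T a x))"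
  using assms
proof (induction A f rule: win.induct)
  case (win_empty f)
  show ?case by (intro exI[of _ "Out []"]) auto
next
  case (win_done A f)
  then show ?case
    by (intro exI[of _ "Out (out A f)"]) (auto simp: participations_def)
next
  case (win_cmp i j A f)
  let ?f = "f(i := Suc (f i), j := Suc (f j))"
  let ?P = "\<lambda>f T a. \<exists>A' f'. G A' f' \<and> a \<in> A' \<and> run T a = out A' f' \<and>
           (\<forall>x. f' x = f x + participations T a x)"
  have "\<exists>T. indices_ok n T \<and> (\<forall>a\<in>{a \<in> A. a i < a j}. ?P ?f T a)"
    by (rule win_cmp.IH(1)) (use win_cmp.prems in blast)
  then obtain T1 where T1: "indices_ok n T1" "\<And>a. a \<in> A \<Longrightarrow> a i < a j \<Longrightarrow> ?P ?f T1 a"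
    by blast
  have "\<exists>T. indices_ok n T \<and> (\<forall>a\<in>{a \<in> A. a j < a i}. ?P ?f T a)"
    by (rule win_cmp.IH(2)) (use win_cmp.prems in blast)
  then obtain T2 where T2: "indices_ok n T2" "\<And>a. a \<in> A \<Longrightarrow> a j < a i \<Longrightarrow> ?P ?f T2 a"
    by blast
  show ?case
  proof (intro exI[of _ "Cmp i j T1 T2"] conjI ballI)
    show "indices_ok n (Cmp i j T1 T2)" using win_cmp.hyps T1 T2 by simp
    fix a assume a: "a \<in> A"
    show "\<exists>A' f'. G A' f' \<and> a \<in> A' \<and> run (Cmp i j T1 T2) a = out A' f' \<and>
           (\<forall>x. f' x = f x + participations (Cmp i j T1 T2) a x)"
    proof (cases "a i < a j")
      case True
      then obtain A' f' where "G A' f'" "a \<in> A'" "run T1 a = out A' f'"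
           "\<forall>x. f' x = ?f x + participations T1 a x" using T1(2)[OF a] by blast
      with True show ?thesis
        using win_cmp.hyps(3) by (intro exI[of _ A'] exI[of _ f']) (auto simp: participations_def)
    next
      case False
      have "a i \<noteq> a j" using win_cmp.prems[OF a] win_cmp.hyps(1-3) by (auto simp: inj_on_def)
      with False have "a j < a i" by simp
      then obtain A' f' where "G A' f'" "a \<in> A'" "run T2 a = out A' f'"
           "\<forall>x. f' x = ?f x + participations T2 a x" using T2(2)[OF a] by blast
      with False show ?thesis
        using win_cmp.hyps(3) by (intro exI[of _ A'] exI[of _ f']) (auto simp: participations_def)
    qed
  qed
qed

section \<open>Knowledge about the order, and batches of comparisons fixed in advance\<close>

text \<open>Knowledge is semantic: a relation is known when all consistent inputs agree on it, so
  every consequence of the answers comes for free. In an empty position everything is known, whence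
  the nonemptiness assumptions below.\<close>

definition before :: "(nat \<Rightarrow> nat) set \<Rightarrow> nat \<Rightarrow> nat \<Rightarrow> bool" where
  "before A x y \<longleftrightarrow> (\<forall>a\<in>A. a x < a y)"

definition decided :: "(nat \<Rightarrow> nat) set \<Rightarrow> nat \<Rightarrow> nat \<Rightarrow> bool" where
  "decided A x y \<longleftrightarrow> before A x y \<or> before A y x"

lemma before_subset: "before A x y \<Longrightarrow> B \<subseteq> A \<Longrightarrow> before B x y"
  by (auto simp: before_def)

lemma decided_subset: "decided A x y \<Longrightarrow> B \<subseteq> A \<Longrightarrow> decided B x y"
  by (auto simp: decided_def intro: before_subset)

lemma before_trans: "before A x y \<Longrightarrow> before A y z \<Longrightarrow> before A x z"
  unfolding before_def by (meson less_trans)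

lemma not_before_cycle: "before A x y \<Longrightarrow> before A y x \<Longrightarrow> A \<noteq> {} \<Longrightarrow> False"
  unfolding before_def by (meson all_not_in_conv less_asym)

lemma decided_cases_at:
  "decided A x y \<Longrightarrow> a \<in> A \<Longrightarrow> a x < a y \<Longrightarrow> before A x y"
  unfolding decided_def before_def by (meson less_asym)

text \<open>For a batch fixed in advance the price of an element is its degree in the graph
  \<open>E\<close>, whatever the answers are.\<close>

lemma win_compare_pairs:
  assumes "finite E" and "\<And>x y. (x, y) \<in> E \<Longrightarrow> x < n \<and> y < n \<and> x \<noteq> y"
  shows "win n (\<lambda>A' f'. (\<forall>(x, y)\<in>E. decided A' x y) \<and>
     (\<forall>x. f' x = f x + card {e \<in> E. fst e = x \<or> snd e = x})) A f"
  using assms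
proof (induction E arbitrary: A f)
  case empty
  show ?case by (rule win_done) simp
next
  case (insert e E)
  obtain i j where e: "e = (i, j)" by force
  let ?f = "f(i := Suc (f i), j := Suc (f j))"
  let ?G = "\<lambda>E f A' f'. (\<forall>(x, y)\<in>E. decided A' x y) \<and>
     (\<forall>x. f' x = f x + card {e \<in> E. fst e = x \<or> snd e = x})"
  have ij: "i < n" "j < n" "i \<noteq> j" using insert.prems[of i j] e by auto
  \<comment> \<open>For every \<open>B\<close>, since the rest of the batch is the same in both
    branches.\<close>
  have W: "win n (?G E ?f) B ?f" for B using insert.prems by (intro insert.IH) blast
  have card: "card {e' \<in> insert e E. fst e' = x \<or> snd e' = x} =
      (if x = i \<or> x = j then 1 else 0) + card {e' \<in> E. fst e' = x \<or> snd e' = x}" for x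
  proof (cases "x = i \<or> x = j")
    case True
    then have "{e' \<in> insert e E. fst e' = x \<or> snd e' = x} =
       insert e {e' \<in> E. fst e' = x \<or> snd e' = x}" using e by auto
    then show ?thesis using True insert.hyps by simp
  next
    case False
    then have "{e' \<in> insert e E. fst e' = x \<or> snd e' = x} =
       {e' \<in> E. fst e' = x \<or> snd e' = x}" using e by auto
    then show ?thesis using False by simp
  qed
  have K: "win n (?G (insert e E) f) B ?f" if "decided B i j" for B
  proof (rule win_mono[OF W])
    fix A' f' assume G: "?G E ?f A' f'" and "A' \<subseteq> B"
    then have "decided A' i j" using that by (blast intro: decided_subset)
    moreover have "f' x = f x + card {e' \<in> insert e E. fst e' = x \<or> snd e' = x}" for x
      using G ij unfolding card by auto
    ultimately show "?G (insert e E) f A' f'" using G e by blast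
  qed
  have "decided {a \<in> A. a i < a j} i j" and "decided {a \<in> A. a j < a i} i j"
    by (auto simp: decided_def before_def)
  then show ?case by (rule win_cmp[OF ij K K])
qed

lemma strict_enumeration:
  fixes a :: "nat \<Rightarrow> nat"
  assumes "finite S" "inj_on a S" "card S = k"
  obtains y where "bij_betw y {..<k} S" "\<And>p q. p < q \<Longrightarrow> q < k \<Longrightarrow> a (y p) < a (y q)"
proof -
  define l where "l = sorted_list_of_set (a ` S)"
  define y where "y p = inv_into S a (l ! p)" for p
  have l: "set l = a ` S" "distinct l" "length l = k" "sorted_wrt (<) l"
    using assms by (auto simp: l_def card_image)
  have ay: "a (y p) = l ! p" if "p < k" for p
    unfolding y_def by (rule f_inv_into_f) (use that l in \<open>metis nth_mem\<close>)
  have yS: "y p \<in> S" if "p < k" for p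
    using that l unfolding y_def by (metis inv_into_into nth_mem)
  have mono: "a (y p) < a (y q)" if "p < q" "q < k" for p q
    using that l sorted_wrt_nth_less[OF l(4)] by (simp add: ay)
  have inj: "inj_on y {..<k}"
  proof (rule inj_onI)
    fix p q assume "p \<in> {..<k}" "q \<in> {..<k}" "y p = y q"
    then show "p = q" using mono[of p q] mono[of q p] by (cases p q rule: linorder_cases) auto
  qed
  have "y ` {..<k} = S"
    by (rule card_subset_eq) (use assms yS inj in \<open>auto simp: card_image\<close>)
  with inj mono show ?thesis by (intro that[of y]) (auto simp: bij_betw_def)
qed

text \<open>An exponential weight lets the strategies pay with total weight instead of with a worst-case
bound: if each of the O(log n) levels of a quicksort multiplies the total weight by a constant, then
the final weight is polynomial in n, so every single exponent is O(log n).\<close>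

definition pot :: "real \<Rightarrow> nat set \<Rightarrow> (nat \<Rightarrow> nat) \<Rightarrow> real" where
  "pot b S f = (\<Sum>x\<in>S. b ^ f x)"

lemma pot_nonneg: "1 < b \<Longrightarrow> 0 \<le> pot b S f"
  by (auto simp: pot_def intro: sum_nonneg)

lemma pot_le_shift:
  assumes "1 < b" "\<And>x. x \<in> S \<Longrightarrow> f' x \<le> f x + k"
  shows "pot b S f' \<le> b ^ k * pot b S f"
  unfolding pot_def sum_distrib_left
proof (rule sum_mono)
  fix x assume "x \<in> S"
  then have "b ^ f' x \<le> b ^ (f x + k)" using assms by (intro power_increasing) auto
  then show "b ^ f' x \<le> b ^ k * b ^ f x" by (simp add: power_add mult.commute)
qed

lemma pot_cong: "(\<And>x. x \<in> S \<Longrightarrow> f x = f' x) \<Longrightarrow> pot b S f = pot b S f'"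
  by (auto simp: pot_def)

lemma pot_Un: "finite S \<Longrightarrow> finite T \<Longrightarrow> S \<inter> T = {} \<Longrightarrow> pot b (S \<union> T) f = pot b S f + pot b T f"
  by (simp add: pot_def sum.union_disjoint)

lemma pot_mono: "1 < b \<Longrightarrow> finite T \<Longrightarrow> S \<subseteq> T \<Longrightarrow> pot b S f \<le> pot b T f"
  unfolding pot_def by (rule sum_mono2) auto

text \<open>The old weight of \<open>X\<close> is not subtracted: the sets \<open>X\<close> in the
  applications carry a small share of the weight, and the crude sum is good enough.\<close>

lemma pot_subset_update:
  assumes "1 < b" "finite Z" "X \<subseteq> Z" "\<And>x. x \<notin> X \<Longrightarrow> f' x = f x"
  shows "pot b Z f' \<le> pot b Z f + pot b X f'"
proof -
  have fin: "finite X" "finite (Z - X)" using assms finite_subset by auto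
  have "pot b Z g = pot b X g + pot b (Z - X) g" for g
    using pot_Un[OF fin] assms(3) by (metis Diff_disjoint Un_Diff_cancel sup.absorb2)
  moreover have "pot b (Z - X) f' = pot b (Z - X) f" using assms by (intro pot_cong) auto
  ultimately show ?thesis using pot_nonneg[OF assms(1), of X f] by simp
qed

lemma win_compare_within:
  assumes fin: "finite I" and sub: "\<And>i. i \<in> I \<Longrightarrow> S i \<subseteq> {..<n}" and card: "\<And>i. i \<in> I \<Longrightarrow> card (S i) \<le> g"
    and disj: "disjoint_family_on S I"
  shows "win n (\<lambda>A' f'. (\<forall>i\<in>I. \<forall>x\<in>S i. \<forall>y\<in>S i. x \<noteq> y \<longrightarrow> decided A' x y) \<and>
     (\<forall>x. f' x \<le> f x + g) \<and> (\<forall>x. x \<notin> \<Union>(S ` I) \<longrightarrow> f' x = f x)) A f"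
proof -
  \<comment> \<open>Ordering by index puts every unordered pair into \<open>E\<close> once, so the
    degree of an element is at most the size of its set.\<close>
  define E where "E = (\<Union>i\<in>I. {(x, y) \<in> S i \<times> S i. x < y})"
  have finS: "finite (S i)" if "i \<in> I" for i using sub[OF that] finite_subset by blast
  have finE: "finite E" unfolding E_def using fin finS
    by (intro finite_UN_I) (auto intro: finite_subset[OF _ finite_cartesian_product])
  have "win n (\<lambda>A' f'. (\<forall>(x, y)\<in>E. decided A' x y) \<and>
     (\<forall>x. f' x = f x + card {e \<in> E. fst e = x \<or> snd e = x})) A f"
    by (rule win_compare_pairs[OF finE]) (use sub in \<open>auto simp: E_def\<close>)
  then show ?thesis
  proof (rule win_mono)
    fix A' f'
    assume G: "(\<forall>(x, y)\<in>E. decided A' x y) \<and>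
     (\<forall>x. f' x = f x + card {e \<in> E. fst e = x \<or> snd e = x})"
    have dec: "decided A' x y" if "i \<in> I" "x \<in> S i" "y \<in> S i" "x \<noteq> y" for i x y
    proof (cases "x < y")
      case True
      then have "(x, y) \<in> E" using that by (auto simp: E_def)
      then show ?thesis using G by auto
    next
      case False
      then have "(y, x) \<in> E" using that by (auto simp: E_def)
      then have "decided A' y x" using G by auto
      then show ?thesis by (auto simp: decided_def)
    qed
    have deg: "card {e \<in> E. fst e = x \<or> snd e = x} \<le> g" for x
    proof (cases "x \<in> \<Union>(S ` I)")
      case True
      then obtain i where i: "i \<in> I" "x \<in> S i" by blast
      have uni: "j = i" if "j \<in> I" "x \<in> S j" for j
        using disj i that by (auto simp: disjoint_family_on_def)
      have "{e \<in> E. fst e = x \<or> snd e = x} \<subseteq> (\<lambda>v. if x < v then (x, v) else (v, x)) ` S i"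
        using uni by (force simp: E_def image_iff)
      then have "card {e \<in> E. fst e = x \<or> snd e = x} \<le> card (S i)"
        using finS[OF i(1)] by (rule surj_card_le[rotated])
      then show ?thesis using card[OF i(1)] by simp
    next
      case False
      then have empty: "{e \<in> E. fst e = x \<or> snd e = x} = {}" by (auto simp: E_def)
      show ?thesis by (simp only: empty card.empty le0)
    qed
    have off: "f' x = f x" if "x \<notin> \<Union>(S ` I)" for x
    proof -
      have empty: "{e \<in> E. fst e = x \<or> snd e = x} = {}" using that by (auto simp: E_def)
      have "f' x = f x + card {e \<in> E. fst e = x \<or> snd e = x}" using G by blast
      then show ?thesis by (simp only: empty card.empty add_0_right)
    qed
    show "(\<forall>i\<in>I. \<forall>x\<in>S i. \<forall>y\<in>S i. x \<noteq> y \<longrightarrow> decided A' x y) \<and>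
     (\<forall>x. f' x \<le> f x + g) \<and> (\<forall>x. x \<notin> \<Union>(S ` I) \<longrightarrow> f' x = f x)"
    proof (intro conjI allI ballI impI)
      fix x show "f' x \<le> f x + g" using deg[of x] G by simp
    qed (use dec off in blast)+
  qed
qed

lemma decided_enumeration:
  assumes "finite S" "card S = k" "A \<noteq> {}"
    and dec: "\<And>x y. x \<in> S \<Longrightarrow> y \<in> S \<Longrightarrow> x \<noteq> y \<Longrightarrow> decided A x y"
  obtains y where "bij_betw y {..<k} S" "\<And>p q. p < q \<Longrightarrow> q < k \<Longrightarrow> before A (y p) (y q)"
proof -
  obtain a where a: "a \<in> A" using assms(3) by blast
  have "inj_on a S"
  proof (rule inj_onI, rule ccontr)
    fix x y assume "x \<in> S" "y \<in> S" "a x = a y" "x \<noteq> y"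
    with dec[of x y] a show False by (auto simp: decided_def before_def)
  qed
  then obtain y where y: "bij_betw y {..<k} S" "\<And>p q. p < q \<Longrightarrow> q < k \<Longrightarrow> a (y p) < a (y q)"
    using strict_enumeration assms by metis
  have "before A (y p) (y q)" if "p < q" "q < k" for p q
  proof -
    have "y p \<in> S" "y q \<in> S" using y(1) that by (auto simp: bij_betw_def)
    moreover have "a (y p) < a (y q)" using y(2) that by blast
    moreover from this have "y p \<noteq> y q" by auto
    ultimately show ?thesis using dec a decided_cases_at by blast
  qed
  with y(1) show ?thesis by (rule that)
qed

section \<open>Subblocks, balanced splits and bucketing\<close>

text \<open>A group of \<open>h * s\<close> elements is sorted completely, at a price depending on
  \<open>h\<close> and \<open>s\<close> only, and cut into \<open>h\<close> runs of length
  \<open>s\<close>. The fewer than \<open>h * s\<close> elements left over by the division lie in no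
  subblock.\<close>

lemma win_subblocks:
  assumes Z: "Z \<subseteq> {..<n}" and G: "G = card Z div (h * s)" and hs: "0 < h * s"
  shows "win n (\<lambda>A' f'. \<exists>S. (\<forall>i\<in>{..<G} \<times> {..<h}. S i \<subseteq> Z \<and> card (S i) = s) \<and>
      disjoint_family_on S ({..<G} \<times> {..<h}) \<and>
      (\<forall>c<G. \<forall>k k'. k < k' \<longrightarrow> k' < h \<longrightarrow> (\<forall>x\<in>S (c, k). \<forall>y\<in>S (c, k'). before A' x y)) \<and>
      (\<forall>x. f' x \<le> f x + h * s) \<and> (\<forall>x. x \<notin> Z \<longrightarrow> f' x = f x)) A f"
proof -
  let ?g = "h * s"
  have finZ: "finite Z" using Z finite_subset by blast
  obtain e where e: "bij_betw e {..<card Z} Z"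
    using ex_bij_betw_nat_finite[OF finZ] by (auto simp: atLeast0LessThan)
  define grp where "grp c = e ` {c * ?g..<c * ?g + ?g}" for c
  have in_range: "{c * ?g..<c * ?g + ?g} \<subseteq> {..<card Z}" if "c < G" for c
  proof -
    have "c * ?g + ?g = Suc c * ?g" by simp
    also have "\<dots> \<le> G * ?g" using that by (intro mult_le_mono1) simp
    also have "\<dots> \<le> card Z" unfolding G by (rule div_times_less_eq_dividend)
    finally show ?thesis by auto
  qed
  have grp: "grp c \<subseteq> Z" "card (grp c) = ?g" if "c < G" for c
  proof -
    show "grp c \<subseteq> Z" using e in_range[OF that] by (auto simp: grp_def bij_betw_def)
    have "inj_on e {c * ?g..<c * ?g + ?g}"
      using e in_range[OF that] by (auto simp: bij_betw_def intro: inj_on_subset)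
    then show "card (grp c) = ?g" by (simp add: grp_def card_image)
  qed
  have grp_disj: "grp c \<inter> grp c' = {}" if "c < G" "c' < G" "c \<noteq> c'" for c c'
  proof -
    have "{c * ?g..<c * ?g + ?g} \<inter> {c' * ?g..<c' * ?g + ?g} = {}"
    proof (rule ccontr)
      assume "{c * ?g..<c * ?g + ?g} \<inter> {c' * ?g..<c' * ?g + ?g} \<noteq> {}"
      then obtain p where "p \<in> {c * ?g..<c * ?g + ?g}" "p \<in> {c' * ?g..<c' * ?g + ?g}" by blast
      then have p: "c * ?g \<le> p" "p < Suc c * ?g" "c' * ?g \<le> p" "p < Suc c' * ?g"
        by simp_all
      then have "p div ?g = c" "p div ?g = c'" by (metis div_nat_eqI mult.commute)+
      then show False using that by simp
    qed
    moreover have "grp c \<inter> grp c' = e ` ({c * ?g..<c * ?g + ?g} \<inter> {c' * ?g..<c' * ?g + ?g})"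
      unfolding grp_def using e in_range that
      by (intro inj_on_image_Int[symmetric, of _ "{..<card Z}"]) (auto simp: bij_betw_def)
    ultimately show ?thesis by simp
  qed
  have "win n (\<lambda>A' f'. (\<forall>i\<in>{..<G}. \<forall>x\<in>grp i. \<forall>y\<in>grp i. x \<noteq> y \<longrightarrow> decided A' x y) \<and>
     (\<forall>x. f' x \<le> f x + ?g) \<and> (\<forall>x. x \<notin> \<Union>(grp ` {..<G}) \<longrightarrow> f' x = f x)) A f"
    by (rule win_compare_within) (use grp Z grp_disj in \<open>auto simp: disjoint_family_on_def\<close>)
  then show ?thesis
  proof (rule win_mono)
    fix A' f'
    assume P: "(\<forall>i\<in>{..<G}. \<forall>x\<in>grp i. \<forall>y\<in>grp i. x \<noteq> y \<longrightarrow> decided A' x y) \<and>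
     (\<forall>x. f' x \<le> f x + ?g) \<and> (\<forall>x. x \<notin> \<Union>(grp ` {..<G}) \<longrightarrow> f' x = f x)" and ne: "A' \<noteq> {}"
    have "\<exists>y. bij_betw y {..<?g} (grp c) \<and> (\<forall>p q. p < q \<longrightarrow> q < ?g \<longrightarrow> before A' (y p) (y q))"
      if c: "c < G" for c
    proof -
      have "finite (grp c)" by (simp add: grp_def)
      then obtain y where "bij_betw y {..<?g} (grp c)"
          "\<And>p q. p < q \<Longrightarrow> q < ?g \<Longrightarrow> before A' (y p) (y q)"
        by (rule decided_enumeration[OF _ grp(2)[OF c] ne]) (use P c in auto)
      then show ?thesis by blast
    qed
    then obtain y where y: "\<And>c. c < G \<Longrightarrow> bij_betw (y c) {..<?g} (grp c)"
        "\<And>c p q. c < G \<Longrightarrow> p < q \<Longrightarrow> q < ?g \<Longrightarrow> before A' (y c p) (y c q)"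
      by metis
    define S where "S i = y (fst i) ` {snd i * s..<snd i * s + s}" for i
    have rng: "{k * s..<k * s + s} \<subseteq> {..<?g}" if "k < h" for k
    proof -
      have "k * s + s = Suc k * s" by simp
      also have "\<dots> \<le> ?g" using that by (intro mult_le_mono1) simp
      finally show ?thesis by auto
    qed
    have lt: "p < q" if "p \<in> {k * s..<k * s + s}" "q \<in> {k' * s..<k' * s + s}" "k < k'" for k k' p q
    proof -
      have "Suc k * s \<le> k' * s" using that by (intro mult_le_mono1) simp
      then show ?thesis using that by auto
    qed
    have S: "S (c, k) \<subseteq> grp c" "card (S (c, k)) = s" if "c < G" "k < h" for c k
    proof -
      show "S (c, k) \<subseteq> grp c" using y(1)[OF that(1)] rng[OF that(2)] by (auto simp: S_def bij_betw_def)
      have "inj_on (y c) {k * s..<k * s + s}"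
        using y(1)[OF that(1)] rng[OF that(2)] by (auto simp: bij_betw_def intro: inj_on_subset)
      then show "card (S (c, k)) = s" by (simp add: S_def card_image)
    qed
    have bef: "before A' x z" if c: "c < G" "k < k'" "k' < h" "x \<in> S (c, k)" "z \<in> S (c, k')" for c k k' x z
    proof -
      obtain p q where pq: "x = y c p" "z = y c q" "p \<in> {k * s..<k * s + s}" "q \<in> {k' * s..<k' * s + s}"
        using c(4,5) by (force simp: S_def)
      have "p < q" using lt pq c by blast
      moreover have "q < ?g" using rng[OF c(3)] pq by auto
      ultimately show ?thesis using y(2) c pq by blast
    qed
    have disj: "S (c, k) \<inter> S (c', k') = {}"
      if "c < G" "k < h" "c' < G" "k' < h" "(c, k) \<noteq> (c', k')" for c k c' k'
    proof (cases "c = c'")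
      case True
      have "before A' x x" if "x \<in> S (c, k)" "x \<in> S (c, k')" for x
        using bef[of c k k' x x] bef[of c k' k x x] \<open>c < G\<close> \<open>k < h\<close> \<open>k' < h\<close> that True
          \<open>(c, k) \<noteq> (c', k')\<close> by (cases k k' rule: linorder_cases) auto
      then show ?thesis using ne True not_before_cycle by blast
    next
      case False
      then show ?thesis using grp_disj S that by blast
    qed
    show "\<exists>S. (\<forall>i\<in>{..<G} \<times> {..<h}. S i \<subseteq> Z \<and> card (S i) = s) \<and>
      disjoint_family_on S ({..<G} \<times> {..<h}) \<and>
      (\<forall>c<G. \<forall>k k'. k < k' \<longrightarrow> k' < h \<longrightarrow> (\<forall>x\<in>S (c, k). \<forall>y\<in>S (c, k'). before A' x y)) \<and>
      (\<forall>x. f' x \<le> f x + h * s) \<and> (\<forall>x. x \<notin> Z \<longrightarrow> f' x = f x)"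
    proof (rule exI[of _ S], intro conjI)
      show "\<forall>i\<in>{..<G} \<times> {..<h}. S i \<subseteq> Z \<and> card (S i) = s" using S grp by fastforce
      show "disjoint_family_on S ({..<G} \<times> {..<h})"
        using disj by (auto simp: disjoint_family_on_def)
      show "\<forall>c<G. \<forall>k k'. k < k' \<longrightarrow> k' < h \<longrightarrow> (\<forall>x\<in>S (c, k). \<forall>y\<in>S (c, k'). before A' x y)"
        using bef by blast
      show "\<forall>x. f' x \<le> f x + h * s" using P by blast
      show "\<forall>x. x \<notin> Z \<longrightarrow> f' x = f x"
      proof (intro allI impI)
        fix x assume "x \<notin> Z"
        then have "x \<notin> \<Union>(grp ` {..<G})" using grp(1) by blast
        then show "f' x = f x" using P by blast
      qed
    qed
  qed
qed

text \<open>Any constant share on both sides gives logarithmic depth; an eighth leaves room for the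
  zones in the middle. Counts outside \<open>Z\<close> stay fixed, so splits of disjoint sets do not
  affect each other's weights.\<close>

definition split_goal :: "real \<Rightarrow> nat set \<Rightarrow> (nat \<Rightarrow> nat) \<Rightarrow> (nat \<Rightarrow> nat) set \<Rightarrow> (nat \<Rightarrow> nat) \<Rightarrow> bool" where
  "split_goal b Z f A' f' \<longleftrightarrow> (\<exists>Z1 Z2. Z1 \<union> Z2 = Z \<and> Z1 \<inter> Z2 = {} \<and>
     card Z \<le> 8 * card Z1 \<and> card Z \<le> 8 * card Z2 \<and> (\<forall>x\<in>Z1. \<forall>y\<in>Z2. before A' x y)) \<and>
     pot b Z f' \<le> 2 * pot b Z f \<and> (\<forall>x. x \<notin> Z \<longrightarrow> f' x = f x)"

text \<open>Quantified over all positions, because recursive calls start wherever the earlier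
  answers have led.\<close>

definition splittable :: "real \<Rightarrow> nat \<Rightarrow> nat set \<Rightarrow> bool" where
  "splittable b n Z \<longleftrightarrow> (\<forall>A f. win n (split_goal b Z f) A f)"

text \<open>Split until every part has at most \<open>hi\<close> elements. A side keeps at most 7/8
  of the elements, so \<open>D\<close> levels suffice; only sets of more than \<open>hi\<close>
  elements are split, so no part falls below \<open>hi / 8\<close>. A level at most doubles the
  weight, hence \<open>2 ^ D\<close>.\<close>

lemma win_bucket:
  assumes b: "1 < b" and hi: "1 \<le> hi"
    and split: "\<And>X. X \<subseteq> M \<Longrightarrow> 2 \<le> card X \<Longrightarrow> splittable b n X"
    and M: "finite M" "hi \<le> 8 * card M" "card M * 7 ^ D \<le> hi * 8 ^ D"
  shows "win n (\<lambda>A' f'. \<exists>lab (N::nat). (\<forall>x\<in>M. lab x < N) \<and>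
      (\<forall>x\<in>M. \<forall>y\<in>M. lab x < lab y \<longrightarrow> before A' x y) \<and>
      (\<forall>i<N. card {x\<in>M. lab x = i} \<le> hi \<and> hi \<le> 8 * card {x\<in>M. lab x = i}) \<and>
      pot b M f' \<le> 2 ^ D * pot b M f \<and> (\<forall>x. x \<notin> M \<longrightarrow> f' x = f x)) A f"
    (is "win n (?goal M D f) A f")
  using split M
proof (induction D arbitrary: M A f)
  case 0
  have c: "card M \<le> hi" using 0(4) by simp
  have "?goal M 0 f A f"
  proof (rule exI[of _ "\<lambda>_::nat. 0::nat"], rule exI[of _ "1::nat"], intro conjI)
    show "\<forall>i<1. card {x \<in> M. (0::nat) = i} \<le> hi \<and> hi \<le> 8 * card {x \<in> M. (0::nat) = i}"
      using c 0(3) by simp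
  qed simp_all
  then show ?case using win_done[of "?goal M 0 f" A f n] by blast
next
  case (Suc D)
  have p0: "0 \<le> pot b M f" using b by (rule pot_nonneg)
  show ?case
  proof (cases "card M \<le> hi")
    case True
    have "1 * pot b M f \<le> 2 ^ Suc D * pot b M f"
      using p0 by (intro mult_right_mono one_le_power) auto
    then have pot: "pot b M f \<le> 2 ^ Suc D * pot b M f" by simp
    have "?goal M (Suc D) f A f"
    proof (rule exI[of _ "\<lambda>_::nat. 0::nat"], rule exI[of _ "1::nat"], intro conjI)
      show "\<forall>i<1. card {x \<in> M. (0::nat) = i} \<le> hi \<and> hi \<le> 8 * card {x \<in> M. (0::nat) = i}"
        using True Suc.prems(3) by simp
    qed (use pot in simp_all)
    then show ?thesis using win_done[of "?goal M (Suc D) f" A f n] by blast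
  next
    case False
    then have "splittable b n M" using Suc.prems(1)[of M] hi by simp
    then have "win n (split_goal b M f) A f" by (simp add: splittable_def)
    then show ?thesis
    proof (rule win_bind, unfold split_goal_def, elim exE conjE)
      fix A1 f1 M1 M2
      assume M12: "M1 \<union> M2 = M" "M1 \<inter> M2 = {}" "card M \<le> 8 * card M1" "card M \<le> 8 * card M2"
        "\<forall>x\<in>M1. \<forall>y\<in>M2. before A1 x y" and f1: "pot b M f1 \<le> 2 * pot b M f"
        "\<forall>x. x \<notin> M \<longrightarrow> f1 x = f x"
      have fin: "finite M1" "finite M2" using M12(1) Suc.prems(2) by auto
      have cM: "card M = card M1 + card M2" using card_Un_disjoint[OF fin M12(2)] M12(1) by simp
      have D: "card X * 7 ^ D \<le> hi * 8 ^ D" if "card X * 8 \<le> 7 * card M" for X :: "nat set"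
      proof -
        have "card X * 8 * 7 ^ D \<le> 7 * card M * 7 ^ D" using that by (rule mult_le_mono1)
        also have "\<dots> \<le> hi * 8 ^ Suc D" using Suc.prems(4) by (simp add: mult_ac)
        finally show ?thesis by simp
      qed
      have sp: "splittable b n X" if "X \<subseteq> M1 \<or> X \<subseteq> M2" "2 \<le> card X" for X
        using Suc.prems(1)[of X] M12(1) that by blast
      have W1: "win n (?goal M1 D f1) A1 f1"
        by (rule Suc.IH[OF sp fin(1) _ D]) (use M12 False cM in auto)
      then show "win n (?goal M (Suc D) f) A1 f1"
      proof (rule win_bind, elim exE conjE)
        fix A2 f2 and lab1 :: "nat \<Rightarrow> nat" and N1 :: nat
        assume A2: "A2 \<subseteq> A1" and l1: "\<forall>x\<in>M1. lab1 x < N1"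
          "\<forall>x\<in>M1. \<forall>y\<in>M1. lab1 x < lab1 y \<longrightarrow> before A2 x y"
          "\<forall>i<N1. card {x\<in>M1. lab1 x = i} \<le> hi \<and> hi \<le> 8 * card {x\<in>M1. lab1 x = i}"
          and f2: "pot b M1 f2 \<le> 2 ^ D * pot b M1 f1" "\<forall>x. x \<notin> M1 \<longrightarrow> f2 x = f1 x"
        have W2: "win n (?goal M2 D f2) A2 f2"
          by (rule Suc.IH[OF sp fin(2) _ D]) (use M12 False cM in auto)
        then show "win n (?goal M (Suc D) f) A2 f2"
        proof (rule win_mono, elim exE conjE)
          fix A3 f3 and lab2 :: "nat \<Rightarrow> nat" and N2 :: nat
          assume A3: "A3 \<subseteq> A2" and l2: "\<forall>x\<in>M2. lab2 x < N2"
            "\<forall>x\<in>M2. \<forall>y\<in>M2. lab2 x < lab2 y \<longrightarrow> before A3 x y"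
            "\<forall>i<N2. card {x\<in>M2. lab2 x = i} \<le> hi \<and> hi \<le> 8 * card {x\<in>M2. lab2 x = i}"
            and f3: "pot b M2 f3 \<le> 2 ^ D * pot b M2 f2" "\<forall>x. x \<notin> M2 \<longrightarrow> f3 x = f2 x"
          define lab where "lab x = (if x \<in> M1 then lab1 x else N1 + lab2 x)" for x
          have lab_M1: "lab x = lab1 x" "lab x < N1" if "x \<in> M1" for x
            using that l1 by (auto simp: lab_def)
          have lab_M2: "lab x = N1 + lab2 x" if "x \<in> M2" for x
            using that M12(2) by (auto simp: lab_def)
          have "lab x < N1 + N2" if "x \<in> M" for x
            using that M12(1) lab_M1[of x] lab_M2[of x] l2 by fastforce
          moreover have "before A3 x y" if xy: "x \<in> M" "y \<in> M" "lab x < lab y" for x y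
          proof -
            consider "x \<in> M1" "y \<in> M1" | "x \<in> M1" "y \<in> M2" | "x \<in> M2" "y \<in> M1" | "x \<in> M2" "y \<in> M2"
              using xy M12(1) by blast
            then show ?thesis
            proof cases
              case 1
              then have "before A2 x y" using l1(2) lab_M1 xy by auto
              then show ?thesis using A3 by (rule before_subset)
            next
              case 2
              then have "before A1 x y" using M12 by blast
              then show ?thesis using A2 A3 by (blast intro: before_subset)
            next
              case 3
              then show ?thesis using lab_M1 lab_M2 xy by fastforce
            next
              case 4
              then show ?thesis using l2(2) lab_M2 xy by auto
            qed
          qed
          moreover have "card {x\<in>M. lab x = i} \<le> hi \<and> hi \<le> 8 * card {x\<in>M. lab x = i}" if "i < N1 + N2" for i
          proof (cases "i < N1")
            case True
            then have "{x\<in>M. lab x = i} = {x\<in>M1. lab1 x = i}"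
              using M12(1) lab_M1 lab_M2 by auto
            then show ?thesis using l1(3) True by simp
          next
            case False
            then have "{x\<in>M. lab x = i} = {x\<in>M2. lab2 x = i - N1}"
              using M12(1) lab_M1 lab_M2 by force
            then show ?thesis using l2(3) False that by simp
          qed
          moreover have "pot b M f3 \<le> 2 ^ Suc D * pot b M f"
          proof -
            have "pot b M1 f3 = pot b M1 f2"
              using f3(2) M12(2) by (intro pot_cong) blast
            moreover have "pot b M2 f2 = pot b M2 f1"
              using f2(2) M12(2) by (intro pot_cong) blast
            moreover have "pot b M g = pot b M1 g + pot b M2 g" for g
              using pot_Un[OF fin M12(2)] M12(1) by simp
            ultimately have "pot b M f3 \<le> 2 ^ D * pot b M f1"
              using f2(1) f3(1) by (simp add: distrib_left)
            also have "\<dots> \<le> 2 ^ D * (2 * pot b M f)" using f1(1) by (intro mult_left_mono) auto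
            finally show ?thesis by (simp add: mult_ac)
          qed
          moreover have "f3 x = f x" if "x \<notin> M" for x
            using that f1(2) f2(2) f3(2) M12(1) by auto
          ultimately show "?goal M (Suc D) f A3 f3" by blast
        qed
      qed
    qed
  qed
qed

text \<open>A jump of the label between two neighbours is noticed at both of them, and the labels
  rise by at most \<open>N - 1\<close> in all. This makes at most \<open>2 * (N - 1)\<close> inner
  positions, and the two ends add 2.\<close>

lemma card_label_changes:
  fixes L :: "nat \<Rightarrow> nat"
  assumes "\<And>k k'. k \<le> k' \<Longrightarrow> k' < h \<Longrightarrow> L k \<le> L k'" and "\<And>k. k < h \<Longrightarrow> L k < N"
  shows "card {k. k < h \<and> (k = 0 \<or> k = h - 1 \<or> L (k - 1) \<noteq> L (k + 1))} \<le> 2 * N"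
proof (cases "h = 0")
  case False
  \<comment> \<open>Telescoping: at a counted position \<open>i\<close> the sum
    \<open>L (i - 1) + L i\<close> grows to \<open>L i + L (i + 1)\<close> by at least 1.\<close>
  have main: "Suc k < h \<Longrightarrow> card {i. 0 < i \<and> i < Suc k \<and> L (i - 1) \<noteq> L (i + 1)} \<le> L k + L (Suc k)" for k
  proof (induction k)
    case 0
    have "{i. 0 < i \<and> i < Suc 0 \<and> L (i - 1) \<noteq> L (i + 1)} = {}" by auto
    then show ?case by (metis card.empty zero_le)
  next
    case (Suc k)
    let ?S = "\<lambda>k. {i. 0 < i \<and> i < Suc k \<and> L (i - 1) \<noteq> L (i + 1)}"
    have m: "L k \<le> L (Suc (Suc k))" using assms Suc.prems by simp
    have S: "?S (Suc k) = ?S k \<union> (if L k \<noteq> L (Suc (Suc k)) then {Suc k} else {})"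
      by (auto simp: less_Suc_eq)
    have "card (?S (Suc k)) \<le> card (?S k) + (if L k \<noteq> L (Suc (Suc k)) then 1 else 0)"
      unfolding S by (rule order_trans[OF card_Un_le]) simp
    then show ?case using Suc m by (auto split: if_splits)
  qed
  let ?B = "{k. k < h \<and> (k = 0 \<or> k = h - 1 \<or> L (k - 1) \<noteq> L (k + 1))}"
  show ?thesis
  proof (cases "h = 1")
    case True
    then have "?B \<subseteq> {0}" by auto
    then have "card ?B \<le> 1" using card_mono[of "{0::nat}" ?B] by simp
    then show ?thesis using assms(2)[of 0] True by simp
  next
    case h: False
    obtain h' where h': "h = Suc (Suc h')" using h False by (metis One_nat_def not0_implies_Suc)
    let ?S = "{i. 0 < i \<and> i < Suc h' \<and> L (i - 1) \<noteq> L (i + 1)}"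
    have "?B \<subseteq> {0, h - 1} \<union> ?S" using h' by auto
    then have "card ?B \<le> card ({0, h - 1} \<union> ?S)" by (intro card_mono) auto
    also have "\<dots> \<le> card {0, h - 1} + card ?S" by (rule card_Un_le)
    also have "\<dots> \<le> 2 + (L h' + L (Suc h'))"
      using main[of h'] h' by (intro add_mono) (auto simp: card_insert_if)
    also have "\<dots> \<le> 2 * N" using assms(2)[of h'] assms(2)[of "Suc h'"] h' by simp
    finally show ?thesis .
  qed
qed simp

section \<open>Approximate bucket sort\<close>

lemma card_eq_sum_fibers:
  assumes "finite M" "\<And>x. x \<in> M \<Longrightarrow> lab x < (N::nat)"
  shows "card M = (\<Sum>i<N. card {x \<in> M. lab x = i})"
proof -
  have "M = (\<Union>i<N. {x \<in> M. lab x = i})" using assms(2) by auto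
  then have "card M = card (\<Union>i<N. {x \<in> M. lab x = i})" by simp
  also have "\<dots> = (\<Sum>i<N. card {x \<in> M. lab x = i})"
    using assms(1) by (intro card_UN_disjoint) auto
  finally show ?thesis .
qed

text \<open>Row c is a group of h sorted consecutive subblocks S (c, k), and the representatives r (c, k)
of all subblocks have been sorted into N buckets. A subblock both of whose neighbours have their
representatives in bucket i lies in the range of that bucket; since labels are monotone along
a row, all but 2 N subblocks per row are located this way.\<close>

lemma classes_from_labels:
  fixes lab :: "nat \<Rightarrow> nat" and S :: "nat \<times> nat \<Rightarrow> nat set" and r :: "nat \<times> nat \<Rightarrow> nat"
  defines "I \<equiv> \<lambda>G h. {..<G} \<times> {..<h}"
  assumes A: "A \<noteq> {}" and finZ: "finite Z" and s: "0 < s"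
    and S: "\<And>p. p \<in> I G h \<Longrightarrow> S p \<subseteq> Z \<and> card (S p) = s"
    and disj: "disjoint_family_on S (I G h)"
    and ordS: "\<And>c k k' x y. c < G \<Longrightarrow> k < k' \<Longrightarrow> k' < h \<Longrightarrow> x \<in> S (c, k) \<Longrightarrow> y \<in> S (c, k') \<Longrightarrow> before A x y"
    and r: "\<And>p. p \<in> I G h \<Longrightarrow> r p \<in> S p"
    and labN: "\<And>p. p \<in> I G h \<Longrightarrow> lab (r p) < N"
    and ordM: "\<And>p q. p \<in> I G h \<Longrightarrow> q \<in> I G h \<Longrightarrow> lab (r p) < lab (r q) \<Longrightarrow> before A (r p) (r q)"
    and fib: "\<And>i. i < N \<Longrightarrow> card {p \<in> I G h. lab (r p) = i} \<le> hi"
      "\<And>i. i < N \<Longrightarrow> hi \<le> 8 * card {p \<in> I G h. lab (r p) = i}"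
    and bad: "64 * (G * N) \<le> hi" and rest: "32 * (card Z - G * h * s) \<le> s * hi"
  shows "\<exists>C. (\<forall>i<N. C i \<subseteq> Z \<and> s * hi \<le> 16 * card (C i) \<and> card (C i) \<le> s * hi) \<and>
     disjoint_family_on C {..<N} \<and> (\<forall>i j. i < j \<longrightarrow> j < N \<longrightarrow> (\<forall>x\<in>C i. \<forall>y\<in>C j. before A x y)) \<and>
     16 * card (Z - \<Union>(C ` {..<N})) \<le> s * hi"
proof -
  define L where "L p = lab (r p)" for p
  have finI: "finite (I G h)" by (simp add: I_def)
  have Lmono: "L (c, k) \<le> L (c, k')" if c: "c < G" "k \<le> k'" "k' < h" for c k k'
  proof (rule ccontr)
    assume "\<not> L (c, k) \<le> L (c, k')"
    then have "L (c, k') < L (c, k)" and "k < k'" using c by (auto simp: le_less)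
    then have "before A (r (c, k')) (r (c, k))" "before A (r (c, k)) (r (c, k'))"
      using c ordM[of "(c, k')" "(c, k)"] ordS[of c k k'] r[of "(c, k)"] r[of "(c, k')"]
      by (auto simp: L_def I_def)
    then show False using A not_before_cycle by blast
  qed
  \<comment> \<open>The end subblocks lack a neighbour and count as bad; this also makes the
    truncated \<open>k - 1\<close> at 0 harmless.\<close>
  define Bd where "Bd c = {k. k < h \<and> (k = 0 \<or> k = h - 1 \<or> L (c, k - 1) \<noteq> L (c, k + 1))}" for c
  define Bad where "Bad = Sigma {..<G} Bd"
  have finBd: "finite (Bd c)" for c by (simp add: Bd_def)
  have cBd: "card (Bd c) \<le> 2 * N" if "c < G" for c
    unfolding Bd_def
    by (rule card_label_changes) (use Lmono labN that in \<open>auto simp: L_def I_def\<close>)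
  have Bad_sub: "Bad \<subseteq> I G h" by (auto simp: Bad_def Bd_def I_def)
  then have finBad: "finite Bad" using finI finite_subset by blast
  have "card Bad = (\<Sum>c<G. card (Bd c))" unfolding Bad_def using finBd by (intro card_SigmaI) auto
  also have "\<dots> \<le> (\<Sum>c<G. 2 * N)" using cBd by (intro sum_mono) auto
  finally have cBad: "32 * card Bad \<le> hi" using bad by simp
  define good where "good i = {p \<in> I G h - Bad. L p = i}" for i
  define C where "C i = \<Union>(S ` good i)" for i
  have good_sub: "good i \<subseteq> I G h" and fin_good: "finite (good i)" for i
    using finI by (auto simp: good_def)
  have finS: "finite (S p)" if "p \<in> I G h" for p using S[OF that] finZ finite_subset by blast
  have card_UN: "card (\<Union>(S ` P)) = s * card P" if P: "P \<subseteq> I G h" for P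
  proof -
    have "finite P" using P finI finite_subset by blast
    moreover have "\<forall>p\<in>P. \<forall>q\<in>P. p \<noteq> q \<longrightarrow> S p \<inter> S q = {}"
      using disj P unfolding disjoint_family_on_def by blast
    moreover have "\<forall>p\<in>P. finite (S p)" using P finS by blast
    ultimately have "card (\<Union>(S ` P)) = (\<Sum>p\<in>P. card (S p))" by (intro card_UN_disjoint)
    also have "\<dots> = (\<Sum>p\<in>P. s)" using P S by (intro sum.cong) auto
    finally show ?thesis by simp
  qed
  have cC: "card (C i) = s * card (good i)" for i
    unfolding C_def by (rule card_UN[OF good_sub])
  have goodN: "card (good i) \<le> hi" "hi \<le> 16 * card (good i)" if "i < N" for i
  proof -
    let ?F = "{p \<in> I G h. lab (r p) = i}"
    have "card (good i) \<le> card ?F" using finI by (intro card_mono) (auto simp: good_def L_def)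
    then show "card (good i) \<le> hi" using fib(1)[OF that] by simp
    \<comment> \<open>A bucket has at least \<open>hi / 8\<close> representatives, and all rows
      together have at most \<open>hi / 32\<close> bad subblocks; what remains is at least
      \<open>hi / 16\<close>.\<close>
    have "?F \<subseteq> good i \<union> Bad" by (auto simp: good_def L_def)
    then have "card ?F \<le> card (good i \<union> Bad)" using fin_good finBad by (intro card_mono) auto
    also have "\<dots> \<le> card (good i) + card Bad" by (rule card_Un_le)
    finally show "hi \<le> 16 * card (good i)" using fib(2)[OF that] cBad by simp
  qed
  have ordC: "before A x y" if ij: "i < j" and xy: "x \<in> C i" "y \<in> C j" for i j x y
  proof -
    obtain c k where x: "(c, k) \<in> good i" "x \<in> S (c, k)" using xy(1) by (auto simp: C_def)
    obtain c' k' where y: "(c', k') \<in> good j" "y \<in> S (c', k')" using xy(2) by (auto simp: C_def)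
    have k: "c < G" "0 < k" "Suc k < h" "L (c, k - 1) = L (c, k + 1)" "L (c, k) = i"
      using x(1) by (auto simp: good_def Bad_def Bd_def I_def)
    have k': "c' < G" "0 < k'" "Suc k' < h" "L (c', k' - 1) = L (c', k' + 1)" "L (c', k') = j"
      using y(1) by (auto simp: good_def Bad_def Bd_def I_def)
    \<comment> \<open>The label of \<open>S (c, k)\<close> is squeezed between the equal labels of
      its neighbours, so the right neighbour has label \<open>i\<close> too; likewise the left
      neighbour of \<open>S (c', k')\<close> has label \<open>j\<close>. The representatives of
      these two neighbours separate \<open>x\<close> from \<open>y\<close>.\<close>
    have "L (c, k + 1) = i" using Lmono[of c "k - 1" k] Lmono[of c k "k + 1"] k by simp
    moreover have "L (c', k' - 1) = j"
      using Lmono[of c' "k' - 1" k'] Lmono[of c' k' "k' + 1"] k' by simp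
    moreover have I: "(c, k + 1) \<in> I G h" "(c', k' - 1) \<in> I G h" using k k' by (auto simp: I_def)
    ultimately have "before A (r (c, k + 1)) (r (c', k' - 1))" using ordM ij by (auto simp: L_def)
    moreover have "before A x (r (c, k + 1))" using ordS[of c k "k + 1" x] x k r I by auto
    moreover have "before A (r (c', k' - 1)) y"
      using ordS[of c' "k' - 1" k' _ y] y k' r[OF I(2)] by auto
    ultimately show ?thesis by (meson before_trans)
  qed
  have disjC: "C i \<inter> C j = {}" if "i \<noteq> j" for i j
  proof -
    have "before A x x" if "x \<in> C i" "x \<in> C j" for x
      using ordC that \<open>i \<noteq> j\<close> by (metis linorder_neqE_nat)
    then show ?thesis using A not_before_cycle by blast
  qed
  have CZ: "C i \<subseteq> Z" for i using S good_sub by (fastforce simp: C_def)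
  have "Z - \<Union>(C ` {..<N}) \<subseteq> (Z - \<Union>(S ` I G h)) \<union> \<Union>(S ` Bad)"
  proof
    fix x assume x: "x \<in> Z - \<Union>(C ` {..<N})"
    show "x \<in> (Z - \<Union>(S ` I G h)) \<union> \<Union>(S ` Bad)"
    proof (cases "x \<in> \<Union>(S ` I G h)")
      case True
      then obtain p where p: "p \<in> I G h" "x \<in> S p" by blast
      have "p \<in> Bad"
      proof (rule ccontr)
        assume "p \<notin> Bad"
        then have "p \<in> good (L p)" using p by (simp add: good_def)
        then have "x \<in> C (L p)" using p(2) unfolding C_def by blast
        then show False using x labN[OF p(1)] by (auto simp: L_def)
      qed
      then show ?thesis using p by blast
    qed (use x in blast)
  qed
  moreover have UBad: "finite (\<Union>(S ` Bad))" using finBad finS Bad_sub by blast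
  ultimately have "card (Z - \<Union>(C ` {..<N})) \<le> card ((Z - \<Union>(S ` I G h)) \<union> \<Union>(S ` Bad))"
    using finZ by (intro card_mono) auto
  also have "\<dots> \<le> card (Z - \<Union>(S ` I G h)) + card (\<Union>(S ` Bad))" by (rule card_Un_le)
  also have "card (Z - \<Union>(S ` I G h)) = card Z - s * card (I G h)"
  proof -
    have "\<Union>(S ` I G h) \<subseteq> Z" using S by blast
    then show ?thesis using finZ card_UN[of "I G h"] by (simp add: card_Diff_subset finite_subset)
  qed
  also have "s * card (I G h) = G * h * s" by (simp add: I_def)
  also have "card (\<Union>(S ` Bad)) = s * card Bad" by (rule card_UN[OF Bad_sub])
  finally have "16 * card (Z - \<Union>(C ` {..<N})) \<le> 16 * (card Z - G * h * s) + 16 * (s * card Bad)"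
    by simp
  \<comment> \<open>Half of the allowance is for the elements outside all groups, half for the bad
    subblocks.\<close>
  moreover have "32 * (s * card Bad) \<le> s * hi" using cBad by (metis mult_le_mono2 mult.left_commute)
  ultimately have E: "16 * card (Z - \<Union>(C ` {..<N})) \<le> s * hi" using rest by linarith
  show ?thesis
  proof (rule exI[of _ C], intro conjI allI impI ballI)
    fix i assume i: "i < N"
    show "C i \<subseteq> Z" by (rule CZ)
    show "s * hi \<le> 16 * card (C i)" using goodN(2)[OF i] by (simp add: cC mult.left_commute)
    show "card (C i) \<le> s * hi" using goodN(1)[OF i] by (simp add: cC)
  qed (use ordC disjC E in \<open>auto simp: disjoint_family_on_def\<close>)
qed

section \<open>Coarse sorting by light representatives\<close>

text \<open>Some term is at most the average. The element found can best afford to take part in the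
  recursive splitting.\<close>

lemma exists_light_element:
  assumes "finite S" "S \<noteq> {}"
  shows "\<exists>x\<in>S. real (card S) * b ^ f x \<le> pot b S f"
proof (rule ccontr)
  assume "\<not> ?thesis"
  then have "pot b S f / card S < b ^ f x" if "x \<in> S" for x
    using that assms by (auto simp: field_simps not_le card_gt_0_iff)
  then have "(\<Sum>x\<in>S. pot b S f / card S) < (\<Sum>x\<in>S. b ^ f x)"
    using assms by (intro sum_strict_mono) auto
  then show False using assms by (simp add: pot_def)
qed

text \<open>\<open>U\<close> is the largest class size allowed. The leftover elements are no more
  than any single class contains, which later allows an injection of them into each class.\<close>

definition coarse_goal ::
  "real \<Rightarrow> real \<Rightarrow> nat \<Rightarrow> nat \<Rightarrow> nat set \<Rightarrow> (nat \<Rightarrow> nat) \<Rightarrow> (nat \<Rightarrow> nat) set \<Rightarrow> (nat \<Rightarrow> nat) \<Rightarrow> bool" where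
  "coarse_goal b c R U Z f A' f' \<longleftrightarrow> (\<exists>C N. N \<le> 8 * R \<and>
     (\<forall>i<N. C i \<subseteq> Z \<and> U \<le> 16 * card (C i) \<and> card (C i) \<le> U) \<and>
     disjoint_family_on C {..<N} \<and> (\<forall>i j. i < j \<longrightarrow> j < N \<longrightarrow> (\<forall>x\<in>C i. \<forall>y\<in>C j. before A' x y)) \<and>
     16 * card (Z - \<Union>(C ` {..<N})) \<le> U) \<and>
     pot b Z f' \<le> c * pot b Z f \<and> (\<forall>x. x \<notin> Z \<longrightarrow> f' x = f x)"

text \<open>There are \<open>R * hi\<close> representatives in buckets of at least
  \<open>hi / 8\<close>, hence at most \<open>8 * R\<close> buckets. Each representative stands for
  \<open>s\<close> elements, so \<open>U = s * hi\<close>. The representatives own at most a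
  fraction \<open>1 / s\<close> of the weight, so splitting them over \<open>D\<close> levels adds
  only \<open>2 ^ D / s\<close>.\<close>

lemma win_coarse:
  assumes b: "1 < b" and R: "1 \<le> R" and s: "2 \<le> s" and D: "R * 7 ^ D \<le> 8 ^ D"
    and h: "h = 512 * R ^ 2" and Z: "Z \<subseteq> {..<n}" and big: "32 * R * (h * s) \<le> card Z"
    and split: "\<And>X. X \<subseteq> Z \<Longrightarrow> 2 \<le> card X \<Longrightarrow> card X < card Z \<Longrightarrow> splittable b n X"
  shows "\<exists>U>0. R * U \<le> card Z \<and> win n (coarse_goal b (b ^ (h * s) * (1 + 2 ^ D / s)) R U Z f) A f"
proof -
  define G where "G = card Z div (h * s)"
  \<comment> \<open>Made for two demands: \<open>G * h = R * hi\<close>, and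
    \<open>64 * (G * N) \<le> hi\<close> for up to \<open>8 * R\<close> buckets, whence 512 = 64 *
    8.\<close>
  define hi where "hi = 512 * R * G"
  have hs: "0 < h * s" using h R s by simp
  have finZ: "finite Z" using Z finite_subset by blast
  have G: "32 * R \<le> G" unfolding G_def using big hs by (simp add: less_eq_div_iff_mult_less_eq)
  then have Gpos: "0 < G" using R by simp
  have hi1: "1 \<le> hi" using Gpos R by (simp add: hi_def)
  have Gh: "G * h = R * hi" by (simp add: h hi_def power2_eq_square)
  have GhsZ: "G * h * s \<le> card Z" unfolding G_def by (simp add: mult.assoc)
  have restZ: "card Z - G * h * s < h * s"
    unfolding G_def using hs by (simp add: mult.assoc minus_div_mult_eq_mod)
  have RU: "R * (s * hi) \<le> card Z" using GhsZ by (simp add: Gh mult_ac)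
  let ?I = "{..<G} \<times> {..<h}"
  have finI: "finite ?I" by simp
  have "win n (coarse_goal b (b ^ (h * s) * (1 + 2 ^ D / s)) R (s * hi) Z f) A f"
  proof (rule win_bind[OF win_subblocks[OF Z G_def hs]], elim exE conjE)
    fix A1 f1 S
    assume S: "\<forall>i\<in>?I. S i \<subseteq> Z \<and> card (S i) = s" and disj: "disjoint_family_on S ?I"
      and ordS: "\<forall>c<G. \<forall>k k'. k < k' \<longrightarrow> k' < h \<longrightarrow> (\<forall>x\<in>S (c, k). \<forall>y\<in>S (c, k'). before A1 x y)"
      and f1: "\<forall>x. f1 x \<le> f x + h * s" "\<forall>x. x \<notin> Z \<longrightarrow> f1 x = f x"
    have finS: "finite (S p)" if "p \<in> ?I" for p using S that finZ finite_subset by blast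
    have "\<exists>x\<in>S p. real s * b ^ f1 x \<le> pot b (S p) f1" if p: "p \<in> ?I" for p
    proof -
      have "card (S p) = s" using S p by blast
      then show ?thesis using exists_light_element[of "S p" b f1] finS[OF p] s by fastforce
    qed
    then obtain r where r: "\<And>p. p \<in> ?I \<Longrightarrow> r p \<in> S p"
      "\<And>p. p \<in> ?I \<Longrightarrow> real s * b ^ f1 (r p) \<le> pot b (S p) f1" by metis
    have inj: "inj_on r ?I"
    proof (rule inj_onI, rule ccontr)
      fix p q assume pq: "p \<in> ?I" "q \<in> ?I" "r p = r q" "p \<noteq> q"
      then have "S p \<inter> S q = {}" using disj unfolding disjoint_family_on_def by blast
      then show False using r(1)[OF pq(1)] r(1)[OF pq(2)] pq(3) by auto
    qed
    define M where "M = r ` ?I"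
    have MZ: "M \<subseteq> Z" using S r(1) by (fastforce simp: M_def)
    have finM: "finite M" by (simp add: M_def)
    have cM: "card M = R * hi" using inj by (simp add: M_def card_image Gh)
    \<comment> \<open>Since \<open>s\<close> is at least 2, the representatives form a strictly
      smaller set, to which the assumption \<open>split\<close> applies.\<close>
    have cMZ: "card M < card Z"
    proof -
      have "0 < R * hi" using R hi1 by simp
      then have "R * hi < R * hi * s" using s by simp
      also have "\<dots> \<le> card Z" using RU by (simp add: mult_ac)
      finally show ?thesis by (simp add: cM)
    qed
    have potM: "real s * pot b M f1 \<le> pot b Z f1"
    proof -
      have "real s * pot b M f1 = (\<Sum>p\<in>?I. real s * b ^ f1 (r p))"
        unfolding M_def pot_def using inj by (simp add: sum.reindex sum_distrib_left)
      also have "\<dots> \<le> (\<Sum>p\<in>?I. pot b (S p) f1)" by (rule sum_mono) (rule r(2))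
      also have "\<dots> = pot b (\<Union>(S ` ?I)) f1"
        unfolding pot_def
      proof (rule sum.UNION_disjoint[symmetric, OF finI])
        show "\<forall>p\<in>?I. \<forall>q\<in>?I. p \<noteq> q \<longrightarrow> S p \<inter> S q = {}"
          using disj unfolding disjoint_family_on_def .
      qed (use finS in blast)
      also have "\<dots> \<le> pot b Z f1"
      proof (rule pot_mono[OF b finZ])
        show "\<Union>(S ` ?I) \<subseteq> Z" using S by blast
      qed
      finally show ?thesis .
    qed
    have "win n (\<lambda>A' f'. \<exists>lab (N::nat). (\<forall>x\<in>M. lab x < N) \<and>
      (\<forall>x\<in>M. \<forall>y\<in>M. lab x < lab y \<longrightarrow> before A' x y) \<and>
      (\<forall>i<N. card {x\<in>M. lab x = i} \<le> hi \<and> hi \<le> 8 * card {x\<in>M. lab x = i}) \<and>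
      pot b M f' \<le> 2 ^ D * pot b M f1 \<and> (\<forall>x. x \<notin> M \<longrightarrow> f' x = f1 x)) A1 f1"
    proof (rule win_bucket[OF b hi1])
      fix X assume "X \<subseteq> M" "2 \<le> card X"
      moreover have "card X \<le> card M" using \<open>X \<subseteq> M\<close> finM by (rule card_mono[rotated])
      ultimately show "splittable b n X" using split[of X] MZ cMZ by auto
    next
      show "hi \<le> 8 * card M" using R by (simp add: cM)
      have "hi * (R * 7 ^ D) \<le> hi * 8 ^ D" using D by (rule mult_le_mono2)
      then show "card M * 7 ^ D \<le> hi * 8 ^ D" by (simp add: cM mult_ac)
    qed (rule finM)
    then show "win n (coarse_goal b (b ^ (h * s) * (1 + 2 ^ D / s)) R (s * hi) Z f) A1 f1"
    proof (rule win_mono, elim exE conjE)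
      fix A2 f2 and lab :: "nat \<Rightarrow> nat" and N :: nat
      assume A2: "A2 \<subseteq> A1" "A2 \<noteq> {}" and lab: "\<forall>x\<in>M. lab x < N"
        "\<forall>x\<in>M. \<forall>y\<in>M. lab x < lab y \<longrightarrow> before A2 x y"
        "\<forall>i<N. card {x\<in>M. lab x = i} \<le> hi \<and> hi \<le> 8 * card {x\<in>M. lab x = i}"
        and f2: "pot b M f2 \<le> 2 ^ D * pot b M f1" "\<forall>x. x \<notin> M \<longrightarrow> f2 x = f1 x"
      have fib: "card {p \<in> ?I. lab (r p) = i} = card {x\<in>M. lab x = i}" for i
      proof -
        have "{x\<in>M. lab x = i} = r ` {p \<in> ?I. lab (r p) = i}" by (auto simp: M_def)
        moreover have "inj_on r {p \<in> ?I. lab (r p) = i}" using inj by (rule inj_on_subset) auto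
        ultimately show ?thesis by (simp add: card_image)
      qed
      have "N * hi = (\<Sum>i<N. hi)" by simp
      also have "\<dots> \<le> (\<Sum>i<N. 8 * card {x\<in>M. lab x = i})" using lab(3) by (intro sum_mono) auto
      also have "\<dots> = 8 * card M"
        unfolding sum_distrib_left[symmetric] using card_eq_sum_fibers[OF finM, of lab N] lab(1) by simp
      finally have "N * hi \<le> (8 * R) * hi" by (simp add: cM mult.assoc)
      then have N: "N \<le> 8 * R" using hi1 by simp
      have bad: "64 * (G * N) \<le> hi"
      proof -
        have "64 * (G * N) \<le> 64 * (G * (8 * R))" using N by (intro mult_le_mono2)
        then show ?thesis by (simp add: hi_def mult_ac)
      qed
      \<comment> \<open>The remainder is smaller than one group, and with at least
        \<open>32 * R\<close> groups a single one is negligible.\<close>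
      have rest: "32 * (card Z - G * h * s) \<le> s * hi"
      proof -
        have "32 * (card Z - G * h * s) \<le> 32 * (h * s)" using restZ by simp
        also have "\<dots> = 512 * R * s * (32 * R)" by (simp add: h power2_eq_square)
        also have "\<dots> \<le> 512 * R * s * G" using G by (intro mult_le_mono2)
        finally show ?thesis by (simp add: hi_def mult_ac)
      qed
      have "\<exists>C. (\<forall>i<N. C i \<subseteq> Z \<and> s * hi \<le> 16 * card (C i) \<and> card (C i) \<le> s * hi) \<and>
         disjoint_family_on C {..<N} \<and> (\<forall>i j. i < j \<longrightarrow> j < N \<longrightarrow> (\<forall>x\<in>C i. \<forall>y\<in>C j. before A2 x y)) \<and>
         16 * card (Z - \<Union>(C ` {..<N})) \<le> s * hi"
      proof (rule classes_from_labels[where S = S and r = r and lab = lab and G = G and h = h])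
        show "before A2 x y" if "c < G" "k < k'" "k' < h" "x \<in> S (c, k)" "y \<in> S (c, k')" for c k k' x y
        proof -
          have "before A1 x y" using ordS that by blast
          then show ?thesis using A2(1) by (rule before_subset)
        qed
        show "card {p \<in> ?I. lab (r p) = i} \<le> hi" "hi \<le> 8 * card {p \<in> ?I. lab (r p) = i}" if "i < N" for i
          using lab(3) that by (simp_all add: fib)
      qed (use A2 finZ s S disj r(1) lab(1,2) bad rest in \<open>auto simp: M_def\<close>)
      moreover have "pot b Z f2 \<le> b ^ (h * s) * (1 + 2 ^ D / s) * pot b Z f"
      proof -
        have "pot b Z f2 \<le> pot b Z f1 + pot b M f2"
          using b finZ MZ f2(2) by (intro pot_subset_update) auto
        also have "\<dots> \<le> pot b Z f1 + 2 ^ D * (pot b Z f1 / s)"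
        proof -
          have "pot b M f1 \<le> pot b Z f1 / s" using potM s by (simp add: field_simps)
          then have "2 ^ D * pot b M f1 \<le> 2 ^ D * (pot b Z f1 / s)" by (intro mult_left_mono) auto
          then show ?thesis using f2(1) by simp
        qed
        also have "\<dots> = (1 + 2 ^ D / s) * pot b Z f1" by (simp add: algebra_simps)
        also have "\<dots> \<le> (1 + 2 ^ D / s) * (b ^ (h * s) * pot b Z f)"
          using pot_le_shift[OF b, of Z f1 f "h * s"] f1(1) by (intro mult_left_mono) auto
        finally show ?thesis by (simp add: mult_ac)
      qed
      moreover have "f2 x = f x" if "x \<notin> Z" for x using f1(2) f2(2) MZ that by auto
      ultimately show "coarse_goal b (b ^ (h * s) * (1 + 2 ^ D / s)) R (s * hi) Z f A2 f2"
        unfolding coarse_goal_def using N by blast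
    qed
  qed
  moreover have "0 < s * hi" using s hi1 by simp
  ultimately show ?thesis using RU by blast
qed

section \<open>Locating the leftover elements, and the light zone\<close>

text \<open>Matching \<open>E\<close> injectively into every class keeps the price fair: an element
  of \<open>E\<close> meets one member of each of the \<open>N\<close> classes, but a class member
  meets at most one element of \<open>E\<close>. A fixed representative of a class would have to
  meet all of \<open>E\<close>.\<close>

lemma win_compare_representatives:
  assumes E: "E \<subseteq> {..<n}" and C: "\<And>i. i < N \<Longrightarrow> C i \<subseteq> {..<n}" "\<And>i. i < N \<Longrightarrow> card E \<le> card (C i)"
    and disj: "disjoint_family_on C {..<N}" "\<And>i. i < N \<Longrightarrow> E \<inter> C i = {}"
  shows "win n (\<lambda>A' f'. \<exists>\<phi>. (\<forall>i<N. \<forall>e\<in>E. \<phi> i e \<in> C i \<and> decided A' e (\<phi> i e)) \<and>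
     (\<forall>x. f' x \<le> f x + (N + 1)) \<and> (\<forall>x. x \<notin> E \<union> \<Union>(C ` {..<N}) \<longrightarrow> f' x = f x)) A f"
proof -
  have finE: "finite E" using E finite_subset by blast
  have finC: "finite (C i)" if "i < N" for i using C(1)[OF that] finite_subset by blast
  have "\<exists>g. inj_on g E \<and> g ` E \<subseteq> C i" if "i < N" for i
    using inj_on_iff_card_le[OF finE finC[OF that]] C(2)[OF that] by simp
  then obtain \<phi> where \<phi>: "\<And>i. i < N \<Longrightarrow> inj_on (\<phi> i) E" "\<And>i. i < N \<Longrightarrow> \<phi> i ` E \<subseteq> C i"
    by metis
  define P where "P = (\<lambda>(i, e). (e, \<phi> i e)) ` ({..<N} \<times> E)"
  have P: "(x, y) \<in> P \<longleftrightarrow> x \<in> E \<and> (\<exists>i<N. y = \<phi> i x)" for x y by (auto simp: P_def)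
  have \<phi>C: "\<phi> i e \<in> C i" "\<phi> i e \<notin> E" if "i < N" "e \<in> E" for i e
    using \<phi>(2) disj(2) that by blast+
  have deg: "card {e \<in> P. fst e = x \<or> snd e = x} \<le> N + 1" for x
  proof (cases "x \<in> E")
    case True
    have "{e \<in> P. fst e = x \<or> snd e = x} \<subseteq> (\<lambda>i. (x, \<phi> i x)) ` {..<N}"
      using True \<phi>C by (auto simp: P_def)
    then have "card {e \<in> P. fst e = x \<or> snd e = x} \<le> card {..<N}"
      by (rule surj_card_le[rotated]) simp
    then show ?thesis by simp
  next
    case False
    have "p = q" if pq: "p \<in> P" "q \<in> P" "snd p = x" "snd q = x" for p q
    proof -
      obtain i e where p: "p = (e, \<phi> i e)" "i < N" "e \<in> E" using pq(1) by (auto simp: P_def)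
      obtain j e' where q: "q = (e', \<phi> j e')" "j < N" "e' \<in> E" using pq(2) by (auto simp: P_def)
      have eq: "\<phi> i e = \<phi> j e'" using p q pq by simp
      then have "C i \<inter> C j \<noteq> {}" using \<phi>C(1)[OF p(2,3)] \<phi>C(1)[OF q(2,3)] by auto
      then have "i = j" using disj(1) p(2) q(2) by (auto simp: disjoint_family_on_def)
      then have "e = e'" using \<phi>(1)[OF p(2)] eq p(3) q(3) by (auto simp: inj_on_def)
      then show ?thesis using p q \<open>i = j\<close> by simp
    qed
    moreover have "fst p \<noteq> x" if "p \<in> P" for p using that False by (auto simp: P_def)
    moreover have "finite {e \<in> P. fst e = x \<or> snd e = x}" using finE by (simp add: P_def)
    ultimately have "card {e \<in> P. fst e = x \<or> snd e = x} \<le> Suc 0"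
      by (subst card_le_Suc0_iff_eq) blast+
    then show ?thesis by simp
  qed
  have "win n (\<lambda>A' f'. (\<forall>(x, y)\<in>P. decided A' x y) \<and>
     (\<forall>x. f' x = f x + card {e \<in> P. fst e = x \<or> snd e = x})) A f"
  proof (rule win_compare_pairs)
    show "finite P" using finE by (simp add: P_def)
    fix x y assume "(x, y) \<in> P"
    then obtain i where "x \<in> E" "i < N" "y = \<phi> i x" by (auto simp: P)
    then show "x < n \<and> y < n \<and> x \<noteq> y" using E C(1)[of i] \<phi>C[of i x] by auto
  qed
  then show ?thesis
  proof (rule win_mono)
    fix A' f'
    assume Q: "(\<forall>(x, y)\<in>P. decided A' x y) \<and>
     (\<forall>x. f' x = f x + card {e \<in> P. fst e = x \<or> snd e = x})"
    show "\<exists>\<phi>. (\<forall>i<N. \<forall>e\<in>E. \<phi> i e \<in> C i \<and> decided A' e (\<phi> i e)) \<and>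
     (\<forall>x. f' x \<le> f x + (N + 1)) \<and> (\<forall>x. x \<notin> E \<union> \<Union>(C ` {..<N}) \<longrightarrow> f' x = f x)"
    proof (intro exI[of _ \<phi>] conjI allI impI ballI)
      fix i e assume ie: "i < N" "e \<in> E"
      show "\<phi> i e \<in> C i" by (rule \<phi>C(1)[OF ie])
      have "(e, \<phi> i e) \<in> P" using ie by (auto simp: P)
      then show "decided A' e (\<phi> i e)" using Q by blast
    next
      fix x show "f' x \<le> f x + (N + 1)" using Q deg[of x] by simp
    next
      fix x assume "x \<notin> E \<union> \<Union>(C ` {..<N})"
      then have empty: "{e \<in> P. fst e = x \<or> snd e = x} = {}" using \<phi>C(1) by (fastforce simp: P_def)
      have "f' x = f x + card {e \<in> P. fst e = x \<or> snd e = x}" using Q by blast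
      then show "f' x = f x" by (simp only: empty card.empty add_0_right)
    qed
  qed
qed

lemma prefix_sum_le:
  fixes w :: "nat \<Rightarrow> nat"
  assumes "\<And>i. i < N \<Longrightarrow> w i \<le> U" "i + k \<le> N"
  shows "(\<Sum>j<i + k. w j) \<le> (\<Sum>j<i. w j) + k * U"
  using assms(2)
proof (induction k)
  case (Suc k)
  then show ?case using assms(1)[of "i + k"] by simp
qed simp

text \<open>\<open>i\<close> is the first index whose prefix holds an eighth of \<open>m\<close>,
  with an overshoot of at most \<open>U\<close>. The next 3000 terms hold at most
  \<open>3000 * U\<close>, a quarter of \<open>m\<close> by the choice of 12000, so more than an
  eighth remains beyond them.\<close>

lemma prefix_window:
  fixes w :: "nat \<Rightarrow> nat"
  assumes w: "\<And>i. i < N \<Longrightarrow> w i \<le> U" and U: "0 < U" "12000 * U \<le> m"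
    and total: "16 * m \<le> 16 * (\<Sum>j<N. w j) + U"
  obtains i where "i + 3000 \<le> N" "m \<le> 8 * (\<Sum>j<i. w j)"
    "m + 8 * (\<Sum>j<i + 3000. w j) \<le> 8 * (\<Sum>j<N. w j)"
proof -
  define P where "P i = (\<Sum>j<i. w j)" for i
  have PN: "m \<le> 8 * P N" using total U by (simp add: P_def)
  define i where "i = (LEAST i. m \<le> 8 * P i)"
  have Pi: "m \<le> 8 * P i" unfolding i_def using PN by (rule LeastI)
  have iN: "i \<le> N" unfolding i_def using PN by (rule Least_le)
  have "i \<noteq> 0"
  proof
    assume "i = 0"
    then show False using Pi U by (simp add: P_def)
  qed
  then obtain i' where i': "i = Suc i'" by (cases i) auto
  have "8 * P i' < m"
    using not_less_Least[of i' "\<lambda>i. m \<le> 8 * P i"] i' by (simp add: i_def[symmetric])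
  moreover have "P i \<le> P i' + U" using w[of i'] iN i' by (simp add: P_def)
  ultimately have Pi_le: "8 * P i \<le> m + 8 * U" by simp
  have bound: "P (i + k) \<le> P i + k * U" if "i + k \<le> N" for k
    using prefix_sum_le[of N w U i k] w that by (simp add: P_def)
  have "i + 3000 \<le> N"
  proof (rule ccontr)
    assume "\<not> i + 3000 \<le> N"
    then have "N - i \<le> 3000" by simp
    then have "(N - i) * U \<le> 3000 * U" by (rule mult_le_mono1)
    moreover have "P N \<le> P i + (N - i) * U" using bound[of "N - i"] iN by simp
    ultimately have "P N \<le> P i + 3000 * U" by linarith
    then show False using Pi_le total U by (simp add: P_def)
  qed
  moreover have "m + 8 * P (i + 3000) \<le> 8 * P N"
    using bound[OF calculation] Pi_le total U by (simp add: P_def)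
  ultimately show ?thesis using that Pi by (simp add: P_def)
qed

text \<open>An element outside the classes is compared with one element of each class only, which leaves it
unlocated between two zones of 300 consecutive classes. Since W consists almost entirely of its core
B, every balanced cut of W has elements of B on both sides and therefore separates Lo from Hi as well;
so it suffices to cut the lightest of ten disjoint zones, at a tenth of the cost.\<close>

lemma exists_light_zone:
  fixes b :: real and N :: nat and C :: "nat \<Rightarrow> nat set"
  assumes A: "A \<noteq> {}" and b: "1 < b" and finZ: "finite Z" and U: "0 < U" "12000 * U \<le> card Z"
    and C: "\<And>i. i < N \<Longrightarrow> C i \<subseteq> Z" "\<And>i. i < N \<Longrightarrow> U \<le> 16 * card (C i)" "\<And>i. i < N \<Longrightarrow> card (C i) \<le> U"
    and disj: "disjoint_family_on C {..<N}"
    and ord: "\<And>i j x y. i < j \<Longrightarrow> j < N \<Longrightarrow> x \<in> C i \<Longrightarrow> y \<in> C j \<Longrightarrow> before A x y"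
    and E: "E = Z - \<Union>(C ` {..<N})" "16 * card E \<le> U"
    and rep: "\<And>i e. i < N \<Longrightarrow> e \<in> E \<Longrightarrow> \<phi> i e \<in> C i" "\<And>i e. i < N \<Longrightarrow> e \<in> E \<Longrightarrow> decided A e (\<phi> i e)"
  obtains Lo W Hi B where "Lo \<union> W \<union> Hi = Z" "Lo \<inter> W = {}" "Lo \<inter> Hi = {}" "W \<inter> Hi = {}" "B \<subseteq> W"
    "\<And>x y. x \<in> Lo \<Longrightarrow> y \<in> B \<Longrightarrow> before A x y" "\<And>x y. x \<in> B \<Longrightarrow> y \<in> Hi \<Longrightarrow> before A x y"
    "8 * card (W - B) < card W" "card Z \<le> 8 * card Lo" "card Z \<le> 8 * card Hi" "2 \<le> card W"
    "10 * pot b W f \<le> pot b Z f"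
proof -
  have finC: "finite (C i)" if "i < N" for i using C(1)[OF that] finZ finite_subset by blast
  have finE: "finite E" using finZ by (simp add: E)
  have disjC: "C i \<inter> C j = {}" if "i < N" "j < N" "i \<noteq> j" for i j
    using disj that unfolding disjoint_family_on_def by blast
  have EC: "x \<notin> C i" if "x \<in> E" "i < N" for x i using that by (auto simp: E)
  have cU: "card (\<Union>(C ` Q)) = (\<Sum>i\<in>Q. card (C i))" if "Q \<subseteq> {..<N}" for Q
  proof (rule card_UN_disjoint)
    show "finite Q" using finite_subset[OF that] by simp
    show "\<forall>i\<in>Q. finite (C i)" using that finC by blast
    show "\<forall>i\<in>Q. \<forall>j\<in>Q. i \<noteq> j \<longrightarrow> C i \<inter> C j = {}" using that disjC by blast
  qed
  have cyc: False if "before A x y" "before A y x" for x y using not_before_cycle that A by blast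
  have total: "16 * card Z \<le> 16 * (\<Sum>j<N. card (C j)) + U"
  proof -
    have sub: "\<Union>(C ` {..<N}) \<subseteq> Z" using C(1) by blast
    have "card Z = card (\<Union>(C ` {..<N})) + card E"
      unfolding E(1) using card_Diff_subset[OF finite_subset[OF sub finZ] sub] card_mono[OF finZ sub] by simp
    then show ?thesis using E(2) cU[of "{..<N}"] by simp
  qed
  obtain i0 where i0: "i0 + 3000 \<le> N" "card Z \<le> 8 * (\<Sum>j<i0. card (C j))"
    "card Z + 8 * (\<Sum>j<i0 + 3000. card (C j)) \<le> 8 * (\<Sum>j<N. card (C j))"
    using prefix_window[of N "\<lambda>i. card (C i)", OF C(3) U total] by blast
  \<comment> \<open>The 3000 classes of the window are exactly ten zones of 300, the border classes
    \<open>l j\<close> and \<open>u j\<close> included.\<close>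
  define l where "l j = i0 + 300 * j" for j
  define u where "u j = i0 + 300 * j + 299" for j
  have lu: "l j < u j" "u j < i0 + 3000" "u j < N" if "j < 10" for j
    using that i0(1) by (auto simp: l_def u_def)
  define W where "W j = \<Union>(C ` {l j..u j}) \<union> {e \<in> E. before A (\<phi> (l j) e) e \<and> before A e (\<phi> (u j) e)}" for j
  have UZ: "\<Union>(C ` Q) \<subseteq> Z" if "Q \<subseteq> {..<N}" for Q using C(1) that by blast
  have EZ: "E \<subseteq> Z" by (auto simp: E)
  have WZ: "W j \<subseteq> Z" if j: "j < 10" for j
  proof -
    have "{l j..u j} \<subseteq> {..<N}" using lu[OF j] by auto
    then show ?thesis using UZ[of "{l j..u j}"] EZ unfolding W_def by blast
  qed
  have disjoint_parts: "(X \<union> V) \<inter> (Y \<union> V') = {}"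
    if "X \<inter> Y = {}" "X \<inter> E = {}" "Y \<inter> E = {}" "V \<subseteq> E" "V' \<subseteq> E" "V \<inter> V' = {}" for X Y V V' :: "nat set"
    using that by blast
  have W_disj: "W j \<inter> W k = {}" if jk: "j < k" "k < 10" for j k
  proof -
    have sep: "u j < l k" using jk by (simp add: l_def u_def)
    have kN: "u k < N" "l k < N" "l j < N" "u j < N" using lu[of k] lu[of j] jk by auto
    show ?thesis unfolding W_def
    proof (rule disjoint_parts)
      have "C i \<inter> C i' = {}" if "i \<in> {l j..u j}" "i' \<in> {l k..u k}" for i i'
        using that sep kN by (intro disjC) auto
      then show "\<Union>(C ` {l j..u j}) \<inter> \<Union>(C ` {l k..u k}) = {}" by blast
      show "\<Union>(C ` {l j..u j}) \<inter> E = {}" "\<Union>(C ` {l k..u k}) \<inter> E = {}"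
        using EC kN by fastforce+
      have False if "e \<in> E" "before A e (\<phi> (u j) e)" "before A (\<phi> (l k) e) e" for e
      proof -
        have "before A (\<phi> (u j) e) (\<phi> (l k) e)" using ord[OF sep kN(2)] rep(1) that(1) kN by blast
        then show False using that cyc before_trans by blast
      qed
      then show "{e \<in> E. before A (\<phi> (l j) e) e \<and> before A e (\<phi> (u j) e)} \<inter>
          {e \<in> E. before A (\<phi> (l k) e) e \<and> before A e (\<phi> (u k) e)} = {}" by blast
    qed blast+
  qed
  have "\<exists>j<10. 10 * pot b (W j) f \<le> pot b Z f"
  proof (rule ccontr)
    assume *: "\<not> ?thesis"
    have "(\<Sum>j<10::nat. pot b Z f / 10) < (\<Sum>j<10::nat. pot b (W j) f)"
      using * by (intro sum_strict_mono) (auto simp: not_le field_simps lessThan_empty_iff)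
    also have "\<dots> = pot b (\<Union>(W ` {..<10})) f"
      unfolding pot_def
    proof (rule sum.UNION_disjoint[symmetric])
      show "\<forall>j\<in>{..<10}. finite (W j)" using WZ finZ finite_subset by blast
      show "\<forall>j\<in>{..<10}. \<forall>k\<in>{..<10}. j \<noteq> k \<longrightarrow> W j \<inter> W k = {}"
        using W_disj by (metis Int_commute lessThan_iff linorder_neqE_nat)
    qed simp
    also have "\<dots> \<le> pot b Z f" using WZ by (intro pot_mono[OF b finZ]) blast
    finally show False by simp
  qed
  then obtain j where j: "j < 10" "10 * pot b (W j) f \<le> pot b Z f" by blast
  let ?l = "l j" and ?u = "u j"
  note lu = lu[OF j(1)]
  have lN: "?l < N" using lu by simp
  define Lo where "Lo = \<Union>(C ` {..<?l}) \<union> {e \<in> E. before A e (\<phi> ?l e)}"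
  define Hi where "Hi = \<Union>(C ` {?u<..<N}) \<union> {e \<in> E. before A (\<phi> ?u e) e}"
  \<comment> \<open>The border classes are left out: a leftover element of \<open>Lo\<close> is only
    known to be below one member of class \<open>?l\<close>, which settles its order against higher
    classes but not against the rest of class \<open>?l\<close>. Class \<open>?u\<close> is
    symmetric.\<close>
  define B where "B = \<Union>(C ` {?l<..<?u})"
  have reps: "before A (\<phi> ?l e) (\<phi> ?u e)" if "e \<in> E" for e
    using ord[OF lu(1,3)] rep(1) that lN lu(3) by blast
  have LoC: "x \<in> Lo \<Longrightarrow> y \<in> C i \<Longrightarrow> ?l < i \<Longrightarrow> i < N \<Longrightarrow> before A x y" for x y i
  proof -
    assume x: "x \<in> Lo" and y: "y \<in> C i" "?l < i" "i < N"
    show ?thesis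
    proof (cases "x \<in> E")
      case True
      then have "before A x (\<phi> ?l x)" using x EC lN by (force simp: Lo_def)
      moreover have "before A (\<phi> ?l x) y" using ord rep(1)[OF lN True] y by blast
      ultimately show ?thesis by (rule before_trans)
    next
      case False
      then obtain i' where "i' < ?l" "x \<in> C i'" using x by (auto simp: Lo_def)
      then show ?thesis using ord[of i' i] y by auto
    qed
  qed
  have HiC: "x \<in> C i \<Longrightarrow> y \<in> Hi \<Longrightarrow> i < ?u \<Longrightarrow> before A x y" for x y i
  proof -
    assume y: "y \<in> Hi" and x: "x \<in> C i" "i < ?u"
    show ?thesis
    proof (cases "y \<in> E")
      case True
      then have "before A (\<phi> ?u y) y" using y EC by (force simp: Hi_def)
      moreover have "before A x (\<phi> ?u y)" using ord rep(1)[OF lu(3) True] x lu(3) by blast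
      ultimately show ?thesis by (meson before_trans)
    next
      case False
      then obtain i' where "?u < i'" "i' < N" "y \<in> C i'" using y by (auto simp: Hi_def)
      then show ?thesis using ord[of i i'] x by auto
    qed
  qed
  have CC: "\<Union>(C ` P) \<inter> \<Union>(C ` Q) = {}" if "P \<subseteq> {..<N}" "Q \<subseteq> {..<N}" "P \<inter> Q = {}" for P Q
  proof -
    have "C p \<inter> C q = {}" if "p \<in> P" "q \<in> Q" for p q
      using that \<open>P \<subseteq> {..<N}\<close> \<open>Q \<subseteq> {..<N}\<close> \<open>P \<inter> Q = {}\<close> by (intro disjC) auto
    then show ?thesis by blast
  qed
  have CE: "\<Union>(C ` P) \<inter> E = {}" if "P \<subseteq> {..<N}" for P using EC that by blast
  have P: "{..<?l} \<subseteq> {..<N}" "{?l..?u} \<subseteq> {..<N}" "{?u<..<N} \<subseteq> {..<N}" "{?l<..<?u} \<subseteq> {..<N}"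
    using lN lu by auto
  have cover: "Lo \<union> W j \<union> Hi = Z"
  proof
    show "Lo \<union> W j \<union> Hi \<subseteq> Z"
      using WZ[OF j(1)] UZ[OF P(1)] UZ[OF P(3)] EZ unfolding Lo_def Hi_def by blast
    show "Z \<subseteq> Lo \<union> W j \<union> Hi"
    proof
      fix x assume x: "x \<in> Z"
      show "x \<in> Lo \<union> W j \<union> Hi"
      proof (cases "x \<in> E")
        case True
        then have "decided A x (\<phi> ?l x)" "decided A x (\<phi> ?u x)" using rep(2) lN lu(3) by blast+
        then show ?thesis using True by (auto simp: decided_def Lo_def W_def Hi_def)
      next
        case False
        then obtain i where i: "i < N" "x \<in> C i" using x by (auto simp: E)
        consider "i < ?l" | "?l \<le> i" "i \<le> ?u" | "?u < i" by linarith
        then have "x \<in> \<Union>(C ` {..<?l}) \<or> x \<in> \<Union>(C ` {?l..?u}) \<or> x \<in> \<Union>(C ` {?u<..<N})"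
        proof cases
          case 1
          then have "i \<in> {..<?l}" by simp
          then show ?thesis using i(2) by blast
        next
          case 2
          then have "i \<in> {?l..?u}" by simp
          then show ?thesis using i(2) by blast
        next
          case 3
          then have "i \<in> {?u<..<N}" using i(1) by simp
          then show ?thesis using i(2) by blast
        qed
        then show ?thesis unfolding Lo_def W_def Hi_def by blast
      qed
    qed
  qed
  have d1: "Lo \<inter> W j = {}"
    unfolding Lo_def W_def
  proof (rule disjoint_parts[OF CC CE CE])
    show "{e \<in> E. before A e (\<phi> ?l e)} \<inter> {e \<in> E. before A (\<phi> ?l e) e \<and> before A e (\<phi> ?u e)} = {}"
      using cyc by blast
  qed (use P in auto)
  have d2: "W j \<inter> Hi = {}"
    unfolding Hi_def W_def
  proof (rule disjoint_parts[OF CC CE CE])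
    show "{e \<in> E. before A (\<phi> ?l e) e \<and> before A e (\<phi> ?u e)} \<inter> {e \<in> E. before A (\<phi> ?u e) e} = {}"
      using cyc by blast
  qed (use P in auto)
  have d3: "Lo \<inter> Hi = {}"
    unfolding Hi_def Lo_def
  proof (rule disjoint_parts[OF CC CE CE])
    have False if "e \<in> E" "before A e (\<phi> ?l e)" "before A (\<phi> ?u e) e" for e
      by (rule cyc[OF that(2) before_trans[OF reps[OF that(1)] that(3)]])
    then show "{e \<in> E. before A e (\<phi> ?l e)} \<inter> {e \<in> E. before A (\<phi> ?u e) e} = {}" by blast
  qed (use P lu in auto)
  have finW: "finite (W j)" "finite Lo" "finite Hi" using cover finZ by auto
  have BW: "B \<subseteq> W j" unfolding B_def W_def by (auto intro!: bexI)
  \<comment> \<open>In units of \<open>U / 16\<close>: the core has at least 298, the rest of the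
    zone at most 16 + 16 + 1 = 33, and 8 * 33 < 298. Zones of 300 classes are long enough for
    this.\<close>
  have cB: "298 * U \<le> 16 * card B"
  proof -
    have "298 * U = (\<Sum>i\<in>{?l<..<?u}. U)" by (simp add: l_def u_def)
    also have "\<dots> \<le> (\<Sum>i\<in>{?l<..<?u}. 16 * card (C i))" using C(2) lu by (intro sum_mono) auto
    also have "\<dots> = 16 * card B" unfolding B_def cU[OF P(4)] by (simp add: sum_distrib_left)
    finally show ?thesis .
  qed
  have cW: "card B \<le> card (W j)" using BW finW by (intro card_mono)
  have "W j - B \<subseteq> C ?l \<union> C ?u \<union> E"
  proof
    fix x assume x: "x \<in> W j - B"
    then consider i where "?l \<le> i" "i \<le> ?u" "x \<in> C i" | "x \<in> E" by (auto simp: W_def)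
    then show "x \<in> C ?l \<union> C ?u \<union> E"
    proof cases
      case (1 i)
      then have "\<not> (?l < i \<and> i < ?u)" using x by (auto simp: B_def)
      then have "i = ?l \<or> i = ?u" using 1 by linarith
      then show ?thesis using 1 by blast
    qed blast
  qed
  then have "card (W j - B) \<le> card (C ?l \<union> C ?u \<union> E)"
    using finC lN lu finE by (intro card_mono) auto
  also have "\<dots> \<le> card (C ?l) + card (C ?u) + card E"
    by (meson add_le_mono1 card_Un_le order_trans)
  finally have "16 * card (W j - B) \<le> 33 * U" using C(3)[OF lN] C(3)[OF lu(3)] E(2) by simp
  then have core: "8 * card (W j - B) < card (W j)" using cB cW U by simp
  have "2 \<le> card (W j)" using cB cW U by simp
  moreover have "card Z \<le> 8 * card Lo"
  proof -
    have "(\<Sum>i<i0. card (C i)) = card (\<Union>(C ` {..<i0}))" using i0(1) by (intro cU[symmetric]) auto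
    also have "\<dots> \<le> card Lo" using finW by (intro card_mono) (auto simp: Lo_def l_def)
    finally show ?thesis using i0(2) by simp
  qed
  moreover have "card Z \<le> 8 * card Hi"
  proof -
    have "(\<Sum>i<N. card (C i)) = (\<Sum>i<i0 + 3000. card (C i)) + (\<Sum>i\<in>{i0 + 3000..<N}. card (C i))"
      using i0(1) by (metis sum.atLeastLessThan_concat atLeast0LessThan zero_le)
    also have "(\<Sum>i\<in>{i0 + 3000..<N}. card (C i)) = card (\<Union>(C ` {i0 + 3000..<N}))"
      by (intro cU[symmetric]) auto
    also have "card (\<Union>(C ` {i0 + 3000..<N})) \<le> card Hi"
      using finW lu(2) by (intro card_mono) (auto simp: Hi_def intro!: bexI)
    finally show ?thesis using i0(3) by simp
  qed
  moreover have "before A x y" if "x \<in> Lo" "y \<in> B" for x y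
    using that LoC lu(3) by (auto simp: B_def)
  moreover have "before A x y" if "x \<in> B" "y \<in> Hi" for x y
    using that HiC by (auto simp: B_def)
  ultimately show ?thesis using that[of Lo "W j" Hi B] cover d1 d2 d3 BW core j(2) by blast
qed

section \<open>Sorting with logarithmic participation\<close>

text \<open>All pairs are compared and the sorted set is cut in the middle; for
  \<open>2 \<le> card Z\<close> the rounded half is still at least a third.\<close>

lemma splittable_small:
  assumes b: "1 < b" "b ^ k \<le> 2" and Z: "Z \<subseteq> {..<n}" "2 \<le> card Z" "card Z \<le> k"
  shows "splittable b n Z"
  unfolding splittable_def
proof (intro allI)
  fix A f
  have finZ: "finite Z" using Z(1) finite_subset by blast
  have "win n (\<lambda>A' f'. (\<forall>i\<in>{()}. \<forall>x\<in>Z. \<forall>y\<in>Z. x \<noteq> y \<longrightarrow> decided A' x y) \<and>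
     (\<forall>x. f' x \<le> f x + k) \<and> (\<forall>x. x \<notin> \<Union>((\<lambda>_. Z) ` {()}) \<longrightarrow> f' x = f x)) A f"
    by (rule win_compare_within) (use Z in \<open>auto simp: disjoint_family_on_def\<close>)
  then show "win n (split_goal b Z f) A f"
  proof (rule win_mono, elim conjE)
    fix A' f'
    assume dec: "\<forall>i\<in>{()}. \<forall>x\<in>Z. \<forall>y\<in>Z. x \<noteq> y \<longrightarrow> decided A' x y" and f': "\<forall>x. f' x \<le> f x + k"
      "\<forall>x. x \<notin> \<Union>((\<lambda>_. Z) ` {()}) \<longrightarrow> f' x = f x" and ne: "A' \<noteq> {}"
    let ?m = "card Z" and ?k = "card Z div 2"
    obtain y where y: "bij_betw y {..<?m} Z" "\<And>p q. p < q \<Longrightarrow> q < ?m \<Longrightarrow> before A' (y p) (y q)"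
      by (rule decided_enumeration[OF finZ refl ne]) (use dec in auto)
    have inj: "inj_on y {..<?m}" and img: "y ` {..<?m} = Z" using y(1) by (auto simp: bij_betw_def)
    have un: "{..<?k} \<union> {?k..<?m} = {..<?m}" by auto
    have "y ` {..<?k} \<inter> y ` {?k..<?m} = y ` ({..<?k} \<inter> {?k..<?m})"
      using inj by (intro inj_on_image_Int[symmetric]) auto
    moreover have "{..<?k} \<inter> {?k..<?m} = {}" by auto
    ultimately have dj: "y ` {..<?k} \<inter> y ` {?k..<?m} = {}" by simp
    have "y ` {..<?k} \<union> y ` {?k..<?m} = Z" unfolding image_Un[symmetric] un by (rule img)
    moreover note dj
    moreover have "card (y ` {..<?k}) = ?k" "card (y ` {?k..<?m}) = ?m - ?k"
    proof -
      have "inj_on y {..<?k}" "inj_on y {?k..<?m}" by (rule inj_on_subset[OF inj], auto)+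
      then show "card (y ` {..<?k}) = ?k" "card (y ` {?k..<?m}) = ?m - ?k" by (simp_all add: card_image)
    qed
    then have "?m \<le> 8 * card (y ` {..<?k})" "?m \<le> 8 * card (y ` {?k..<?m})"
      using Z(2) by linarith+
    moreover have "\<forall>x\<in>y ` {..<?k}. \<forall>z\<in>y ` {?k..<?m}. before A' x z" using y(2) by auto
    moreover have "pot b Z f' \<le> 2 * pot b Z f"
    proof -
      have "pot b Z f' \<le> b ^ k * pot b Z f" using f'(1) by (intro pot_le_shift b) auto
      also have "\<dots> \<le> 2 * pot b Z f" using b pot_nonneg by (intro mult_right_mono) auto
      finally show ?thesis .
    qed
    moreover have "\<forall>x. x \<notin> Z \<longrightarrow> f' x = f x" using f'(2) by simp
    ultimately show "split_goal b Z f A' f'" unfolding split_goal_def by blast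
  qed
qed

text \<open>The constants: 12000 classes leave room for ten zones of 300 in the middle quarter; bucketing the
representatives down to a fraction 1 / 12000 takes 71 levels, as 12000 * (7 / 8) ^ 71 is below 1, and costs
a factor 2 ^ 71, which subblocks of size 2 ^ 74 reduce to 1 / 8.\<close>

definition group_size :: nat where "group_size = 512 * 12000 ^ 2 * 2 ^ 74"
text \<open>The size from which \<open>win_coarse\<close> applies with \<open>R = 12000\<close>. It
  also bounds the price of sorting a smaller set outright and the price
  \<open>N + 1 + group_size\<close> paid outside the recursion, so that a single condition on
  \<open>b\<close> covers everything.\<close>

definition budget :: nat where "budget = 32 * 12000 * group_size"

text \<open>The induction hypothesis enters twice, for sets of representatives inside
  \<open>win_coarse\<close> and for the light zone. The bound closes since 11/10 * 9/8 is at most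
  5/4, and 5/4 * 6/5 is at most 2.\<close>

lemma splittable_all:
  assumes b: "1 < b" "b ^ budget \<le> 11 / 10" and Z: "Z \<subseteq> {..<n}" "2 \<le> card Z"
  shows "splittable b n Z"
  using Z
proof (induction "card Z" arbitrary: Z rule: less_induct)
  case (less Z)
  have finZ: "finite Z" using less.prems(1) finite_subset by blast
  show ?case
  proof (cases "card Z \<le> budget")
    case True
    then show ?thesis using b less.prems by (intro splittable_small[where k = budget]) auto
  next
    case False
    let ?c = "b ^ group_size * (1 + 2 ^ 71 / 2 ^ 74)"
    show ?thesis unfolding splittable_def
    proof (intro allI)
      fix A f
      have "\<exists>U>0. 12000 * U \<le> card Z \<and> win n (coarse_goal b ?c 12000 U Z f) A f"
        using win_coarse[of b 12000 "2 ^ 74" 71 "512 * 12000 ^ 2" Z n f A] b(1) less.prems(1) less.hyps False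
        by (auto simp: budget_def group_size_def)
      then obtain U where U: "0 < U" "12000 * U \<le> card Z"
        and W0: "win n (coarse_goal b ?c 12000 U Z f) A f" by blast
      from W0 show "win n (split_goal b Z f) A f"
      proof (rule win_bind, unfold coarse_goal_def, elim conjE exE)
        fix A1 f1 C and N :: nat
        assume N: "N \<le> 8 * 12000"
          and C: "\<forall>i<N. C i \<subseteq> Z \<and> U \<le> 16 * card (C i) \<and> card (C i) \<le> U"
          and disj: "disjoint_family_on C {..<N}"
          and ord: "\<forall>i j. i < j \<longrightarrow> j < N \<longrightarrow> (\<forall>x\<in>C i. \<forall>y\<in>C j. before A1 x y)"
          and rest: "16 * card (Z - \<Union>(C ` {..<N})) \<le> U"
          and f1: "pot b Z f1 \<le> ?c * pot b Z f" "\<forall>x. x \<notin> Z \<longrightarrow> f1 x = f x"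
        define E where "E = Z - \<Union>(C ` {..<N})"
        have "win n (\<lambda>A' f'. \<exists>\<phi>. (\<forall>i<N. \<forall>e\<in>E. \<phi> i e \<in> C i \<and> decided A' e (\<phi> i e)) \<and>
           (\<forall>x. f' x \<le> f1 x + (N + 1)) \<and> (\<forall>x. x \<notin> E \<union> \<Union>(C ` {..<N}) \<longrightarrow> f' x = f1 x)) A1 f1"
        proof (rule win_compare_representatives[OF _ _ _ disj])
          show "E \<subseteq> {..<n}" using less.prems(1) by (auto simp: E_def)
          fix i assume i: "i < N"
          then show "C i \<subseteq> {..<n}" "card E \<le> card (C i)" "E \<inter> C i = {}"
            using C rest less.prems(1) by (fastforce simp: E_def)+
        qed
        then show "win n (split_goal b Z f) A1 f1"
        proof (rule win_bind, elim exE conjE)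
          fix A2 f2 \<phi>
          assume A2: "A2 \<subseteq> A1" "A2 \<noteq> {}"
            and \<phi>: "\<forall>i<N. \<forall>e\<in>E. \<phi> i e \<in> C i \<and> decided A2 e (\<phi> i e)"
            and f2: "\<forall>x. f2 x \<le> f1 x + (N + 1)" "\<forall>x. x \<notin> E \<union> \<Union>(C ` {..<N}) \<longrightarrow> f2 x = f1 x"
          have f2_off: "f2 x = f x" if "x \<notin> Z" for x
          proof -
            have "x \<notin> E \<union> \<Union>(C ` {..<N})" using C that by (auto simp: E_def)
            then show ?thesis using f2(2) f1(2) that by simp
          qed
          have pot2: "pot b Z f2 \<le> 5 / 4 * pot b Z f"
          proof -
            have "pot b Z f2 \<le> b ^ (N + 1) * pot b Z f1"
              using f2(1) by (intro pot_le_shift b) auto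
            also have "\<dots> \<le> b ^ (N + 1) * (?c * pot b Z f)"
              using f1(1) b(1) by (intro mult_left_mono) auto
            also have "\<dots> = b ^ (N + 1 + group_size) * (9 / 8) * pot b Z f"
              by (simp add: power_add)
            also have "\<dots> \<le> 11 / 10 * (9 / 8) * pot b Z f"
            proof (intro mult_right_mono pot_nonneg b(1))
              have "N + 1 + group_size \<le> budget" using N by (simp add: budget_def group_size_def)
              then have "b ^ (N + 1 + group_size) \<le> b ^ budget" using b(1) by (intro power_increasing) auto
              then show "b ^ (N + 1 + group_size) \<le> 11 / 10" using b(2) by simp
            qed simp
            also have "\<dots> \<le> 5 / 4 * pot b Z f"
              using pot_nonneg[OF b(1)] by (intro mult_right_mono) auto
            finally show ?thesis .
          qed
          obtain Lo W Hi B where zone: "Lo \<union> W \<union> Hi = Z" "Lo \<inter> W = {}" "Lo \<inter> Hi = {}" "W \<inter> Hi = {}" "B \<subseteq> W"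
            "\<And>x y. x \<in> Lo \<Longrightarrow> y \<in> B \<Longrightarrow> before A2 x y" "\<And>x y. x \<in> B \<Longrightarrow> y \<in> Hi \<Longrightarrow> before A2 x y"
            "8 * card (W - B) < card W" "card Z \<le> 8 * card Lo" "card Z \<le> 8 * card Hi" "2 \<le> card W"
            "10 * pot b W f2 \<le> pot b Z f2"
          proof (rule exists_light_zone[OF A2(2) b(1) finZ U _ _ _ disj _ E_def])
            show "before A2 x y" if "i < j" "j < N" "x \<in> C i" "y \<in> C j" for i j x y
            proof -
              have "before A1 x y" using ord that by blast
              then show ?thesis using A2(1) by (rule before_subset)
            qed
            show "C i \<subseteq> Z" "U \<le> 16 * card (C i)" "card (C i) \<le> U" if "i < N" for i
              using C that by blast+
            show "16 * card E \<le> U" using rest by (simp add: E_def)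
            show "\<phi> i e \<in> C i" "decided A2 e (\<phi> i e)" if "i < N" "e \<in> E" for i e
              using \<phi> that by blast+
          qed (rule that; assumption)
          have fin: "finite Lo" "finite W" "finite Hi" using zone(1) finZ by auto
          have "W \<subset> Z"
          proof -
            have "card Lo \<noteq> 0" using zone(9) less.prems(2) by linarith
            then have "Lo \<noteq> {}" by auto
            then show ?thesis using zone(1,2) by blast
          qed
          then have "splittable b n W"
            using less.prems(1) zone(11) psubset_card_mono[OF finZ] by (intro less.hyps) auto
          then have "win n (split_goal b W f2) A2 f2" by (simp add: splittable_def)
          then show "win n (split_goal b Z f) A2 f2"
          proof (rule win_mono, unfold split_goal_def[of _ W], elim exE conjE)
            fix A3 f3 Z1 Z2
            assume A3: "A3 \<subseteq> A2" and W: "Z1 \<union> Z2 = W" "Z1 \<inter> Z2 = {}" "card W \<le> 8 * card Z1"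
              "card W \<le> 8 * card Z2" "\<forall>x\<in>Z1. \<forall>y\<in>Z2. before A3 x y"
              and f3: "pot b W f3 \<le> 2 * pot b W f2" "\<forall>x. x \<notin> W \<longrightarrow> f3 x = f2 x"
            have meets: "\<exists>c\<in>V. c \<in> B" if "V \<subseteq> W" "card W \<le> 8 * card V" for V
            proof (rule ccontr)
              assume "\<not> ?thesis"
              then have "V \<subseteq> W - B" using that(1) by blast
              then have "card V \<le> card (W - B)" using fin(2) by (intro card_mono) auto
              then show False using that(2) zone(8) by simp
            qed
            obtain c1 c2 where c: "c1 \<in> Z1" "c1 \<in> B" "c2 \<in> Z2" "c2 \<in> B"
              using meets[of Z1] meets[of Z2] W by blast
            have lo: "before A3 x y" if "x \<in> Lo" "y \<in> B" for x y
              using zone(6) that A3 before_subset by blast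
            have hi: "before A3 x y" if "x \<in> B" "y \<in> Hi" for x y
              using zone(7) that A3 before_subset by blast
            have "before A3 x y" if xy: "x \<in> Lo \<union> Z1" "y \<in> Z2 \<union> Hi" for x y
            proof -
              \<comment> \<open>\<open>c2\<close> is above everything in
                \<open>Lo \<union> Z1\<close> and \<open>c1\<close> below everything in
                \<open>Z2 \<union> Hi\<close>; only for a pair from \<open>Z1\<close> and
                \<open>Z2\<close> is the split of \<open>W\<close> itself needed.\<close>
              have x: "before A3 x c2" using lo W(5) c xy(1) by blast
              have y: "before A3 c1 y" using hi W(5) c xy(2) by blast
              consider "x \<in> Z1" "y \<in> Z2" | "x \<in> Lo" | "y \<in> Hi" using xy by blast
              then show ?thesis
              proof cases
                case 1
                then show ?thesis using W(5) by blast
              next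
                case 2
                then show ?thesis using lo[of x c1] c y before_trans by blast
              next
                case 3
                then show ?thesis using hi[of c2 y] c x before_trans by blast
              qed
            qed
            moreover have "(Lo \<union> Z1) \<union> (Z2 \<union> Hi) = Z" "(Lo \<union> Z1) \<inter> (Z2 \<union> Hi) = {}"
              using zone(1-4) W(1,2) by blast+
            moreover have "card Z \<le> 8 * card (Lo \<union> Z1)" "card Z \<le> 8 * card (Z2 \<union> Hi)"
            proof -
              have "card Lo \<le> card (Lo \<union> Z1)" "card Hi \<le> card (Z2 \<union> Hi)"
                using fin W(1) by (auto intro!: card_mono)
              then show "card Z \<le> 8 * card (Lo \<union> Z1)" "card Z \<le> 8 * card (Z2 \<union> Hi)"
                using zone(9,10) by simp_all
            qed
            moreover have "pot b Z f3 \<le> 2 * pot b Z f"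
            proof -
              have "pot b Z f3 \<le> pot b Z f2 + pot b W f3"
                using b(1) finZ zone(1) f3(2) by (intro pot_subset_update) auto
              \<comment> \<open>The zone has at most a tenth of the weight and its split doubles it
                at most: an added fifth.\<close>
              also have "\<dots> \<le> 6 / 5 * pot b Z f2" using f3(1) zone(12) by simp
              also have "\<dots> \<le> 2 * pot b Z f" using pot2 pot_nonneg[OF b(1), of Z f] by simp
              finally show ?thesis .
            qed
            moreover have "f3 x = f x" if "x \<notin> Z" for x
              using f3(2) f2_off that zone(1) by auto
            ultimately show "split_goal b Z f A3 f3" unfolding split_goal_def by blast
          qed
        qed
      qed
    qed
  qed
qed

section \<open>Quicksort on balanced splits\<close>

text \<open>Sides shrink to at most 7/8, so depth \<open>d\<close> suffices once
  \<open>card S * (7 / 8) ^ d\<close> is at most 1. Comparisons within one side leave the weight of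
  the other unchanged, so a level at most doubles the total.\<close>

lemma win_sort_pot:
  assumes split: "\<And>X. X \<subseteq> {..<n} \<Longrightarrow> 2 \<le> card X \<Longrightarrow> splittable b n X" and b: "1 < b"
    and S: "S \<subseteq> {..<n}" "card S * 7 ^ d \<le> 8 ^ d"
  shows "win n (\<lambda>A' f'. (\<forall>x\<in>S. \<forall>y\<in>S. x \<noteq> y \<longrightarrow> decided A' x y) \<and>
     pot b S f' \<le> 2 ^ d * pot b S f \<and> (\<forall>x. x \<notin> S \<longrightarrow> f' x = f x)) A f"
    (is "win n (?goal S d f) A f")
  using S
proof (induction d arbitrary: S A f)
  case 0
  have finS: "finite S" using 0(1) finite_subset by blast
  then have "\<forall>x\<in>S. \<forall>y\<in>S. x = y" using 0(2) by (simp add: card_le_Suc0_iff_eq)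
  then have "?goal S 0 f A f" by simp
  then show ?case using win_done[of "?goal S 0 f"] by blast
next
  case (Suc d)
  have finS: "finite S" using Suc.prems(1) finite_subset by blast
  show ?case
  proof (cases "2 \<le> card S")
    case False
    then have "\<forall>x\<in>S. \<forall>y\<in>S. x = y" using card_le_Suc0_iff_eq[OF finS] by auto
    moreover have "1 * pot b S f \<le> 2 ^ Suc d * pot b S f"
      using pot_nonneg[OF b] by (intro mult_right_mono one_le_power) auto
    ultimately have "?goal S (Suc d) f A f" by simp
    then show ?thesis using win_done[of "?goal S (Suc d) f"] by blast
  next
    case True
    then have "win n (split_goal b S f) A f" using split Suc.prems(1) by (simp add: splittable_def)
    then show ?thesis
    proof (rule win_bind, unfold split_goal_def, elim exE conjE)
      fix A1 f1 S1 S2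
      assume S12: "S1 \<union> S2 = S" "S1 \<inter> S2 = {}" "card S \<le> 8 * card S1" "card S \<le> 8 * card S2"
        "\<forall>x\<in>S1. \<forall>y\<in>S2. before A1 x y" and f1: "pot b S f1 \<le> 2 * pot b S f"
        "\<forall>x. x \<notin> S \<longrightarrow> f1 x = f x"
      have sub: "S1 \<subseteq> {..<n}" "S2 \<subseteq> {..<n}" using S12(1) Suc.prems(1) by auto
      have fin: "finite S1" "finite S2" using S12(1) finS by auto
      have cS: "card S = card S1 + card S2" using card_Un_disjoint[OF fin S12(2)] S12(1) by simp
      have d: "card X * 7 ^ d \<le> 8 ^ d" if "card X * 8 \<le> 7 * card S" for X :: "nat set"
      proof -
        have "card X * 8 * 7 ^ d \<le> 7 * card S * 7 ^ d" using that by (rule mult_le_mono1)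
        also have "\<dots> \<le> 8 ^ Suc d" using Suc.prems(2) by (simp add: mult_ac)
        finally show ?thesis by simp
      qed
      have "win n (?goal S1 d f1) A1 f1" by (rule Suc.IH[OF sub(1) d]) (use cS S12 in simp)
      then show "win n (?goal S (Suc d) f) A1 f1"
      proof (rule win_bind, elim conjE)
        fix A2 f2
        assume A2: "A2 \<subseteq> A1" and dec1: "\<forall>x\<in>S1. \<forall>y\<in>S1. x \<noteq> y \<longrightarrow> decided A2 x y"
          and f2: "pot b S1 f2 \<le> 2 ^ d * pot b S1 f1" "\<forall>x. x \<notin> S1 \<longrightarrow> f2 x = f1 x"
        have "win n (?goal S2 d f2) A2 f2" by (rule Suc.IH[OF sub(2) d]) (use cS S12 in simp)
        then show "win n (?goal S (Suc d) f) A2 f2"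
        proof (rule win_mono, elim conjE)
          fix A3 f3
          assume A3: "A3 \<subseteq> A2" and dec2: "\<forall>x\<in>S2. \<forall>y\<in>S2. x \<noteq> y \<longrightarrow> decided A3 x y"
            and f3: "pot b S2 f3 \<le> 2 ^ d * pot b S2 f2" "\<forall>x. x \<notin> S2 \<longrightarrow> f3 x = f2 x"
          have cross: "decided A3 x y" "decided A3 y x" if "x \<in> S1" "y \<in> S2" for x y
          proof -
            have "before A1 x y" using S12(5) that by blast
            then have "before A3 x y" by (rule before_subset) (use A2 A3 in auto)
            then show "decided A3 x y" "decided A3 y x" by (simp_all add: decided_def)
          qed
          have "decided A3 x y" if "x \<in> S1" "y \<in> S1" "x \<noteq> y" for x y
            using dec1 that A3 decided_subset by blast
          then have "\<forall>x\<in>S. \<forall>y\<in>S. x \<noteq> y \<longrightarrow> decided A3 x y"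
            using cross dec2 S12(1) by blast
          moreover have "pot b S f3 \<le> 2 ^ Suc d * pot b S f"
          proof -
            have "pot b S1 f3 = pot b S1 f2" using f3(2) S12(2) by (intro pot_cong) blast
            moreover have "pot b S2 f2 = pot b S2 f1" using f2(2) S12(2) by (intro pot_cong) blast
            moreover have "pot b S g = pot b S1 g + pot b S2 g" for g
              using pot_Un[OF fin S12(2)] S12(1) by simp
            ultimately have "pot b S f3 \<le> 2 ^ d * pot b S f1"
              using f2(1) f3(1) by (simp add: distrib_left)
            also have "\<dots> \<le> 2 ^ d * (2 * pot b S f)" using f1(1) by (intro mult_left_mono) auto
            finally show ?thesis by (simp add: mult_ac)
          qed
          moreover have "\<forall>x. x \<notin> S \<longrightarrow> f3 x = f x"
            using f1(2) f2(2) f3(2) S12(1) by auto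
          ultimately show "?goal S (Suc d) f A3 f3" by blast
        qed
      qed
    qed
  qed
qed

definition sort_goal :: "nat \<Rightarrow> nat set \<Rightarrow> (nat \<Rightarrow> nat) \<Rightarrow> (nat \<Rightarrow> nat) set \<Rightarrow> (nat \<Rightarrow> nat) \<Rightarrow> bool" where
  "sort_goal k S f A' f' \<longleftrightarrow> (\<forall>x\<in>S. \<forall>y\<in>S. x \<noteq> y \<longrightarrow> decided A' x y) \<and>
     (\<forall>x. f' x \<le> f x + k) \<and> (\<forall>x. x \<notin> S \<longrightarrow> f' x = f x)"

text \<open>A single term \<open>b ^ f'' x\<close> is at most the final weight, and \<open>q\<close>
  is chosen so that \<open>b ^ (q * t)\<close> dominates this weight. Neither \<open>b\<close> nor
  \<open>q\<close> depends on \<open>n\<close>, \<open>t\<close> or \<open>S\<close>.\<close>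

lemma win_sort:
  "\<exists>q. \<forall>n t S A f. S \<subseteq> {..<n} \<longrightarrow> card S \<le> 2 ^ t \<longrightarrow> win n (sort_goal (q * t) S f) A f"
proof -
  define b :: real where "b = root budget (11 / 10)"
  have bud: "0 < budget" by (simp add: budget_def group_size_def)
  have b: "1 < b" "b ^ budget \<le> 11 / 10" unfolding b_def using real_root_gt_1_iff[OF bud] real_root_pow_pos2[OF bud] by simp_all
  obtain q where q: "2 ^ 7 < b ^ q" using real_arch_pow[OF b(1), of "2 ^ 7"] ..
  show ?thesis
  proof (intro exI[of _ q] allI impI)
    fix n t :: nat and S A and f :: "nat \<Rightarrow> nat"
    assume S: "S \<subseteq> {..<n}" "card S \<le> 2 ^ t"
    have finS: "finite S" using S(1) finite_subset by blast
    \<comment> \<open>Six levels per factor of two, as \<open>2 * 7 ^ 6 \<le> 8 ^ 6\<close>; five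
      would just fail.\<close>
    have "card S * 7 ^ (6 * t) \<le> 2 ^ t * (7 ^ 6) ^ t" using S(2) by (simp add: power_mult)
    also have "\<dots> = (2 * 7 ^ 6) ^ t" by (rule power_mult_distrib[symmetric])
    also have "\<dots> \<le> (8 ^ 6) ^ t" by (intro power_mono) auto
    finally have d: "card S * 7 ^ (6 * t) \<le> 8 ^ (6 * t)" by (simp add: power_mult)
    \<comment> \<open>Started at zero, where the initial weight is \<open>card S\<close>; earlier
      counts would otherwise enter the bound.\<close>
    have "win n (\<lambda>A' f'. (\<forall>x\<in>S. \<forall>y\<in>S. x \<noteq> y \<longrightarrow> decided A' x y) \<and>
     pot b S f' \<le> 2 ^ (6 * t) * pot b S (\<lambda>_. 0) \<and> (\<forall>x. x \<notin> S \<longrightarrow> f' x = 0)) A (\<lambda>_. 0)"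
      using win_sort_pot[of n b S "6 * t" "\<lambda>_. 0" A] splittable_all[OF b] b(1) S(1) d by simp
    from win_shift[OF this, of f]
    have "win n (\<lambda>A' f'. \<exists>f''. ((\<forall>x\<in>S. \<forall>y\<in>S. x \<noteq> y \<longrightarrow> decided A' x y) \<and>
     pot b S f'' \<le> 2 ^ (6 * t) * pot b S (\<lambda>_. 0) \<and> (\<forall>x. x \<notin> S \<longrightarrow> f'' x = 0)) \<and>
       (\<forall>x. f' x = f'' x + f x)) A f" by simp
    then show "win n (sort_goal (q * t) S f) A f"
    proof (rule win_mono, elim exE conjE)
      fix A' f' f''
      assume dec: "\<forall>x\<in>S. \<forall>y\<in>S. x \<noteq> y \<longrightarrow> decided A' x y"
        and f'': "pot b S f'' \<le> 2 ^ (6 * t) * pot b S (\<lambda>_. 0)" "\<forall>x. x \<notin> S \<longrightarrow> f'' x = 0"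
        and f': "\<forall>x. f' x = f'' x + f x"
      have "f'' x \<le> q * t" if x: "x \<in> S" for x
      proof -
        have "b ^ f'' x \<le> pot b S f''" unfolding pot_def
          using x finS b(1) by (intro member_le_sum) auto
        also have "\<dots> \<le> 2 ^ (6 * t) * real (card S)" using f''(1) by (simp add: pot_def)
        also have "\<dots> \<le> 2 ^ (6 * t) * 2 ^ t" using S(2) by (intro mult_left_mono) (simp_all add: of_nat_le_iff[symmetric] del: of_nat_le_iff)
        also have "\<dots> = (2 ^ 7) ^ t" by (simp only: power_mult[symmetric] power_add[symmetric]) simp
        also have "\<dots> \<le> (b ^ q) ^ t" using q by (intro power_mono) auto
        finally have "b ^ f'' x \<le> b ^ (q * t)" by (simp add: power_mult)
        then show ?thesis using b(1) power_le_imp_le_exp by blast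
      qed
      then have "f'' x \<le> q * t" for x using f''(2) by (cases "x \<in> S") auto
      then show "sort_goal (q * t) S f A' f'" unfolding sort_goal_def using dec f' f''(2) by simp
    qed
  qed
qed

section \<open>Adaptivity\<close>

text \<open>By disjointness an element takes part in at most one of the sorts, so \<open>k\<close>
  is paid once and not once per set.\<close>

lemma win_sort_family:
  fixes m :: nat
  assumes q: "\<And>S A f. S \<subseteq> {..<n} \<Longrightarrow> card S \<le> 2 ^ t \<Longrightarrow> win n (sort_goal k S f) A f"
    and S: "\<And>c. c < m \<Longrightarrow> S c \<subseteq> {..<n}" "\<And>c. c < m \<Longrightarrow> card (S c) \<le> 2 ^ t"
    and disj: "\<And>c c'. c < c' \<Longrightarrow> c' < m \<Longrightarrow> S c \<inter> S c' = {}"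
  shows "win n (\<lambda>A' f'. (\<forall>c<m. \<forall>x\<in>S c. \<forall>y\<in>S c. x \<noteq> y \<longrightarrow> decided A' x y) \<and>
     (\<forall>x. f' x \<le> f x + k) \<and> (\<forall>x. x \<notin> \<Union>(S ` {..<m}) \<longrightarrow> f' x = f x)) A f"
    (is "win n (?goal m) A f")
  using S disj
proof (induction m)
  case 0
  have "?goal 0 A f" by simp
  then show ?case using win_done[of "?goal 0"] by blast
next
  case (Suc m)
  have "win n (?goal m) A f" by (rule Suc.IH) (use Suc.prems in auto)
  then show ?case
  proof (rule win_bind, elim conjE)
    fix A1 f1
    assume dec: "\<forall>c<m. \<forall>x\<in>S c. \<forall>y\<in>S c. x \<noteq> y \<longrightarrow> decided A1 x y"
      and f1: "\<forall>x. f1 x \<le> f x + k" "\<forall>x. x \<notin> \<Union>(S ` {..<m}) \<longrightarrow> f1 x = f x"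
    have "win n (sort_goal k (S m) f1) A1 f1" using q Suc.prems(1,2)[of m] by simp
    then show "win n (?goal (Suc m)) A1 f1"
    proof (rule win_mono, unfold sort_goal_def, elim conjE)
      fix A2 f2
      assume A2: "A2 \<subseteq> A1" and dec2: "\<forall>x\<in>S m. \<forall>y\<in>S m. x \<noteq> y \<longrightarrow> decided A2 x y"
        and f2: "\<forall>x. f2 x \<le> f1 x + k" "\<forall>x. x \<notin> S m \<longrightarrow> f2 x = f1 x"
      have "decided A2 x y" if "c < Suc m" "x \<in> S c" "y \<in> S c" "x \<noteq> y" for c x y
      proof (cases "c = m")
        case False
        then have "c < m" using that by simp
        then have "decided A1 x y" using dec that(2-) by blast
        then show ?thesis using A2 by (rule decided_subset)
      qed (use dec2 that in blast)
      moreover have "f2 x \<le> f x + k" for x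
      proof (cases "x \<in> S m")
        case True
        then have "x \<notin> \<Union>(S ` {..<m})" using Suc.prems(3)[of _ m] by blast
        then show ?thesis using f1(2) f2(1) by metis
      next
        case False
        then show ?thesis using f1(1) f2(2) by simp
      qed
      moreover have "f2 x = f x" if "x \<notin> \<Union>(S ` {..<Suc m})" for x
        using that f1(2) f2(2) by (simp add: lessThan_Suc)
      ultimately show "?goal (Suc m) A2 f2" by blast
    qed
  qed
qed

lemma Inv_ge:
  assumes "P \<subseteq> {(i, j). i < j \<and> j < n \<and> a i > a j}"
  shows "card P \<le> Inv n a"
proof -
  have "{(i, j). i < j \<and> j < n \<and> a i > a j} \<subseteq> {..<n} \<times> {..<n}" by auto
  then have "finite {(i, j). i < j \<and> j < n \<and> a i > a j}" by (rule finite_subset) simp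
  then show ?thesis unfolding Inv_def using assms by (rule card_mono)
qed

lemma Inv_le: "Inv n a \<le> n * n"
proof -
  have "Inv n a \<le> card ({..<n} \<times> {..<n})" unfolding Inv_def by (rule card_mono) auto
  then show ?thesis by simp
qed

text \<open>Elements are grouped into windows of 2 H consecutive positions; block number c + 1 consists of the
elements of window c that are not among its H smallest, and of the H smallest of window c + 1. For at
most H inversions the blocks are already in the right order: every violation of it would be witnessed
by more than H inversions.\<close>

definition window :: "nat \<Rightarrow> nat \<Rightarrow> nat \<Rightarrow> nat set" where
  "window n H c = {x. x < n \<and> x div (2 * H) = c}"

definition block :: "nat \<Rightarrow> nat \<Rightarrow> (nat \<Rightarrow> nat) \<Rightarrow> nat \<Rightarrow> nat" where
  "block n H a x = x div (2 * H) +
     (if card {z \<in> window n H (x div (2 * H)). a z < a x} < H then 0 else 1)"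

lemma finite_window: "finite (window n H c)"
  by (simp add: window_def)

lemma window_subset: "0 < H \<Longrightarrow> window n H c \<subseteq> {c * (2 * H)..<c * (2 * H) + 2 * H}"
proof
  fix x assume "0 < H" "x \<in> window n H c"
  then show "x \<in> {c * (2 * H)..<c * (2 * H) + 2 * H}"
    using div_times_less_eq_dividend[of x "2 * H"] dividend_less_div_times[of "2 * H" x]
    by (simp add: window_def)
qed

lemma card_window_le: "0 < H \<Longrightarrow> card (window n H c) \<le> 2 * H"
  using card_mono[OF _ window_subset[of H n c]] by simp

lemma window_full:
  assumes "0 < H" "c < y div (2 * H)" "y < n"
  shows "card (window n H c) = 2 * H"
proof -
  have "Suc c * (2 * H) \<le> y" using assms(2) by (metis Suc_leI div_times_less_eq_dividend le_trans mult_le_mono1)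
  then have "{c * (2 * H)..<c * (2 * H) + 2 * H} \<subseteq> window n H c"
    using assms by (auto simp: window_def algebra_simps intro!: div_nat_eqI)
  then have "window n H c = {c * (2 * H)..<c * (2 * H) + 2 * H}"
    using window_subset[OF assms(1)] by blast
  then show ?thesis by simp
qed

lemma less_if_block_less:
  assumes H: "0 < H" "Inv n a \<le> H" and a: "inj_on a {..<n}"
    and xy: "x < n" "y < n" "block n H a x < block n H a y"
  shows "a x < a y"
proof (rule ccontr)
  assume "\<not> a x < a y"
  moreover have "x \<noteq> y" using xy by auto
  then have "a x \<noteq> a y" using a xy by (auto simp: inj_on_def)
  ultimately have lt: "a y < a x" by simp
  define c where "c = x div (2 * H)"
  define d where "d = y div (2 * H)"
  define below where "below v = {z \<in> window n H (v div (2 * H)). a z < a v}" for v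
  define above where "above v = {z \<in> window n H (v div (2 * H)). a v < a z}" for v
  have fin: "finite (below v)" "finite (above v)" for v
    using finite_window by (auto simp: below_def above_def)
  have blk: "block n H a v = v div (2 * H) + (if card (below v) < H then 0 else 1)" for v
    by (simp add: block_def below_def)
  have div_less: "u < v" if "u div (2 * H) < v div (2 * H)" for u v
    using that div_le_mono[of v u "2 * H"] by (cases "u < v") auto
  \<comment> \<open>Otherwise \<open>y\<close> and at least \<open>H\<close> smaller elements of its
    window all come after \<open>x\<close> and are smaller than \<open>x\<close>: more than
    \<open>H\<close> inversions.\<close>
  have high: "card (below y) < H" if cd: "c < d"
  proof (rule ccontr)
    assume "\<not> card (below y) < H"
    moreover have "card (Pair x ` insert y (below y)) \<le> Inv n a"
    proof (rule Inv_ge, rule subsetI)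
      fix p assume "p \<in> Pair x ` insert y (below y)"
      then obtain z where z: "p = (x, z)" "z = y \<or> z \<in> below y" by blast
      then have "z < n" "z div (2 * H) = d" "a z < a x"
        using xy(2) lt by (auto simp: below_def window_def d_def)
      then show "p \<in> {(i, j). i < j \<and> j < n \<and> a i > a j}"
        using z(1) div_less[of x z] cd by (simp add: c_def)
    qed
    moreover have "card (Pair x ` insert y (below y)) = Suc (card (below y))"
      using fin(1)[of y] by (subst card_image) (auto simp: inj_on_def below_def)
    ultimately show False using H by simp
  qed
  \<comment> \<open>Window \<open>c\<close> is full because \<open>y\<close> lies in a later one. If
    \<open>x\<close> were among its \<open>H\<close> smallest, then \<open>x\<close> and at least
    \<open>H\<close> larger elements of the window would come before \<open>y\<close> and exceed
    it.\<close>
  have low: "\<not> card (below x) < H" if cd: "c < d"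
  proof
    assume bx: "card (below x) < H"
    have "window n H c \<subseteq> insert x (below x \<union> above x)"
    proof
      fix z assume z: "z \<in> window n H c"
      have "z = x" if "a z = a x" using inj_onD[OF a that] z xy(1) by (simp add: window_def)
      then show "z \<in> insert x (below x \<union> above x)"
        using z by (cases "a z" "a x" rule: linorder_cases) (auto simp: below_def above_def c_def)
    qed
    then have "card (window n H c) \<le> card (insert x (below x \<union> above x))"
      using fin by (intro card_mono) auto
    moreover have "card (window n H c) = 2 * H"
      using window_full[OF H(1) _ xy(2)] cd by (simp add: d_def)
    ultimately have "2 * H \<le> card (insert x (below x \<union> above x))" by simp
    also have "\<dots> \<le> Suc (card (below x \<union> above x))" using fin by (simp add: card_insert_if)
    also have "\<dots> \<le> Suc (card (below x) + card (above x))" by (simp add: card_Un_le)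
    finally have ab: "H \<le> card (above x)" using bx by simp
    have "card ((\<lambda>z. (z, y)) ` insert x (above x)) \<le> Inv n a"
    proof (rule Inv_ge, rule subsetI)
      fix p assume "p \<in> (\<lambda>z. (z, y)) ` insert x (above x)"
      then obtain z where z: "p = (z, y)" "z = x \<or> z \<in> above x" by blast
      then have "z div (2 * H) = c" "a y < a z"
        using lt by (auto simp: above_def window_def c_def)
      then show "p \<in> {(i, j). i < j \<and> j < n \<and> a i > a j}"
        using z(1) xy(2) div_less[of z y] cd by (simp add: d_def)
    qed
    moreover have "card ((\<lambda>z. (z, y)) ` insert x (above x)) = Suc (card (above x))"
      using fin(2)[of x] by (subst card_image) (auto simp: inj_on_def above_def)
    ultimately show False using H ab by simp
  qed
  consider "d < c" | "c = d" | "d = c + 1" | "c + 1 < d" by linarith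
  then show False
  proof cases
    case 1
    then show False using xy(3) by (auto simp: blk c_def d_def split: if_splits)
  next
    case 2
    then have "below y \<subseteq> below x" using lt by (auto simp: below_def c_def d_def)
    then have "card (below y) \<le> card (below x)" by (rule card_mono[OF fin(1)])
    then show False using xy(3) 2 by (auto simp: blk c_def d_def split: if_splits)
  next
    case 3
    then show False using high low xy(3) by (auto simp: blk c_def d_def split: if_splits)
  next
    case 4
    \<comment> \<open>Every element of a full window in between is inverted with \<open>x\<close> if
      it is smaller than \<open>x\<close>, and with \<open>y\<close> otherwise: \<open>2 * H\<close>
      inversions.\<close>
    let ?g = "\<lambda>z. if a z < a x then (x, z) else (z, y)"
    have "card (?g ` window n H (c + 1)) \<le> Inv n a"
    proof (rule Inv_ge, rule subsetI)
      fix p assume "p \<in> ?g ` window n H (c + 1)"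
      then obtain z where z: "z < n" "z div (2 * H) = c + 1" "p = ?g z" by (auto simp: window_def)
      then have "x < z" "z < y" using div_less[of x z] div_less[of z y] 4 by (auto simp: c_def d_def)
      moreover from this have "a z \<noteq> a x" using inj_onD[OF a, of z x] z(1) xy(1) by auto
      ultimately show "p \<in> {(i, j). i < j \<and> j < n \<and> a i > a j}" using z lt xy by auto
    qed
    moreover have "inj_on ?g (window n H (c + 1))"
    proof (rule inj_onI)
      fix z z' assume z: "z \<in> window n H (c + 1)" "z' \<in> window n H (c + 1)" "?g z = ?g z'"
      then have "x \<noteq> z" "x \<noteq> z'" using 4 by (auto simp: window_def c_def)
      then show "z = z'" using z(3) by (auto split: if_splits)
    qed
    then have "card (?g ` window n H (c + 1)) = card (window n H (c + 1))" by (rule card_image)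
    moreover have "card (window n H (c + 1)) = 2 * H"
      using 4 xy(2) by (intro window_full[OF H(1)]) (auto simp: d_def)
    ultimately show False using H by simp
  qed
qed

text \<open>Sorting the windows makes \<open>block\<close> the same function for all consistent
  inputs, so the second round knows which sets to sort. Inputs with more than \<open>H\<close>
  inversions may remain consistent, so the result only says that the others agree.\<close>

lemma win_block_sort:
  assumes q: "\<And>S A f. S \<subseteq> {..<n} \<Longrightarrow> card S \<le> 2 ^ t \<Longrightarrow> win n (sort_goal k S f) A f"
    and H: "0 < H" "4 * H \<le> 2 ^ t" and A: "\<And>a. a \<in> A \<Longrightarrow> inj_on a {..<n}"
  shows "win n (\<lambda>A' f'. (\<forall>a\<in>A'. \<forall>a'\<in>A'. Inv n a \<le> H \<longrightarrow> Inv n a' \<le> H \<longrightarrow>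
      (\<forall>x<n. \<forall>y<n. a x < a y \<longrightarrow> a' x < a' y)) \<and> (\<forall>x. f' x \<le> f x + 2 * k)) A f"
proof (rule win_bind[OF win_sort_family[OF q, where S = "window n H" and m = n]], assumption, assumption, goal_cases)
  case (1 c)
  then show ?case by (auto simp: window_def)
next
  case (2 c)
  then show ?case using card_window_le[OF H(1), of n c] H(2) by simp
next
  case (3 c c')
  then show ?case by (auto simp: window_def)
next
  case (4 A1 f1)
  then have dec: "\<And>c x y. c < n \<Longrightarrow> x \<in> window n H c \<Longrightarrow> y \<in> window n H c \<Longrightarrow> x \<noteq> y \<Longrightarrow> decided A1 x y"
    and f1: "\<And>x. f1 x \<le> f x + k" and A1: "A1 \<subseteq> A" "A1 \<noteq> {}" by blast+
  obtain a0 where a0: "a0 \<in> A1" using A1 by blast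
  define B where "B c = {x. x < n \<and> block n H a0 x = c}" for c
  have dec': "decided A1 x y" if "x < n" "y < n" "x div (2 * H) = y div (2 * H)" "x \<noteq> y" for x y
  proof (rule dec[of "x div (2 * H)"])
    have "x div (2 * H) \<le> x" by (rule div_le_dividend)
    then show "x div (2 * H) < n" using that(1) by linarith
  qed (use that in \<open>auto simp: window_def\<close>)
  have blk: "block n H a x = block n H a0 x" if "a \<in> A1" "x < n" for a x
  proof -
    have "a z < a x \<longleftrightarrow> a0 z < a0 x" if z: "z \<in> window n H (x div (2 * H))" for z
    proof (cases "z = x")
      case False
      then have "decided A1 z x" using z \<open>x < n\<close> by (intro dec') (auto simp: window_def)
      then show ?thesis using a0 \<open>a \<in> A1\<close> by (fastforce simp: decided_def before_def)
    qed simp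
    then have "{z \<in> window n H (x div (2 * H)). a z < a x} = {z \<in> window n H (x div (2 * H)). a0 z < a0 x}"
      by blast
    then show ?thesis by (simp add: block_def)
  qed
  have B_card: "card (B c) \<le> 2 ^ t" for c
  proof -
    \<comment> \<open>For \<open>c = 0\<close> the truncated \<open>c - 1\<close> repeats window 0,
      which does no harm.\<close>
    have "B c \<subseteq> window n H c \<union> window n H (c - 1)"
      by (auto simp: B_def block_def window_def)
    then have "card (B c) \<le> card (window n H c \<union> window n H (c - 1))"
      using finite_window by (intro card_mono) auto
    also have "\<dots> \<le> card (window n H c) + card (window n H (c - 1))" by (rule card_Un_le)
    also have "\<dots> \<le> 2 * H + 2 * H" using card_window_le[OF H(1)] by (intro add_mono)
    finally show ?thesis using H(2) by simp
  qed
  have W: "win n (\<lambda>A' f'. (\<forall>c<Suc n. \<forall>x\<in>B c. \<forall>y\<in>B c. x \<noteq> y \<longrightarrow> decided A' x y) \<and>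
     (\<forall>x. f' x \<le> f1 x + k) \<and> (\<forall>x. x \<notin> \<Union>(B ` {..<Suc n}) \<longrightarrow> f' x = f1 x)) A1 f1"
    by (rule win_sort_family[OF q]) (use B_card in \<open>auto simp: B_def\<close>)
  show ?case
  proof (rule win_mono[OF W], elim conjE)
    fix A2 f2
    assume dec2: "\<forall>c<Suc n. \<forall>x\<in>B c. \<forall>y\<in>B c. x \<noteq> y \<longrightarrow> decided A2 x y"
      and f2: "\<forall>x. f2 x \<le> f1 x + k" and A2: "A2 \<subseteq> A1"
    have "a' x < a' y" if aa: "a \<in> A2" "a' \<in> A2" "Inv n a \<le> H" "Inv n a' \<le> H"
      and xy: "x < n" "y < n" "a x < a y" for a a' x y
    proof -
      have inj: "inj_on a {..<n}" "inj_on a' {..<n}" using A A1 A2 aa by blast+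
      have bl: "block n H a v = block n H a0 v" "block n H a' v = block n H a0 v" if "v < n" for v
        using blk that A2 aa by blast+
      consider "block n H a0 x < block n H a0 y" | "block n H a0 y < block n H a0 x"
        | "block n H a0 x = block n H a0 y" by linarith
      then show ?thesis
      proof cases
        case 1
        then show ?thesis using less_if_block_less[OF H(1) aa(4) inj(2) xy(1,2)] bl xy by simp
      next
        case 2
        then show ?thesis using less_if_block_less[OF H(1) aa(3) inj(1) xy(2,1)] bl xy by simp
      next
        case 3
        have "x div (2 * H) \<le> x" by (rule div_le_dividend)
        then have "x div (2 * H) < n" using xy(1) by linarith
        then have "block n H a0 x < Suc n" by (auto simp: block_def)
        then have "decided A2 x y" using dec2 3 xy by (auto simp: B_def)
        then show ?thesis using aa xy(3) by (fastforce simp: decided_def before_def)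
      qed
    qed
    moreover have "f2 x \<le> f x + 2 * k" for x using f1[of x] spec[OF f2, of x] by simp
    ultimately show "(\<forall>a\<in>A2. \<forall>a'\<in>A2. Inv n a \<le> H \<longrightarrow> Inv n a' \<le> H \<longrightarrow>
      (\<forall>x<n. \<forall>y<n. a x < a y \<longrightarrow> a' x < a' y)) \<and> (\<forall>x. f2 x \<le> f x + 2 * k)" by blast
  qed
qed

section \<open>Testing a guess, and squaring it\<close>

definition stage_goal :: "nat \<Rightarrow> nat \<Rightarrow> nat \<Rightarrow> (nat \<Rightarrow> nat) \<Rightarrow> (nat \<Rightarrow> nat) set \<Rightarrow> (nat \<Rightarrow> nat) \<Rightarrow> bool" where
  "stage_goal n H k f A' f' \<longleftrightarrow>
     ((\<exists>xs. distinct xs \<and> set xs = {..<n} \<and> (\<forall>a\<in>A'. sorted (map a xs))) \<or> (\<forall>a\<in>A'. H < Inv n a)) \<and>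
     (\<forall>x. f' x \<le> f x + k)"

text \<open>The candidate is the order of \<open>a0\<close>, and verifying it costs every element at
  most 2. If an input with at most \<open>H\<close> inversions survives the verification, the
  answers confirm the candidate for all survivors, whatever their inversions; if none survives, the
  guess is refuted.\<close>

lemma win_stage:
  assumes q: "\<And>S A f. S \<subseteq> {..<n} \<Longrightarrow> card S \<le> 2 ^ t \<Longrightarrow> win n (sort_goal k S f) A f"
    and H: "0 < H" "4 * H \<le> 2 ^ t" and A: "\<And>a. a \<in> A \<Longrightarrow> inj_on a {..<n}"
  shows "win n (stage_goal n H (2 * k + 2) f) A f"
proof (rule win_bind[OF win_block_sort[OF q H A]], assumption, assumption, assumption, elim conjE)
  fix A1 f1
  assume A1: "A1 \<subseteq> A" and f1: "\<forall>x. f1 x \<le> f x + 2 * k"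
    and agree: "\<forall>a\<in>A1. \<forall>a'\<in>A1. Inv n a \<le> H \<longrightarrow> Inv n a' \<le> H \<longrightarrow>
      (\<forall>x<n. \<forall>y<n. a x < a y \<longrightarrow> a' x < a' y)"
  show "win n (stage_goal n H (2 * k + 2) f) A1 f1"
  \<comment> \<open>Costs no comparison: it only asks which inputs are still consistent.\<close>
  proof (cases "\<exists>a\<in>A1. Inv n a \<le> H")
    case False
    then have "stage_goal n H (2 * k + 2) f A1 f1"
      unfolding stage_goal_def using f1 by (auto simp: not_le trans_le_add1 intro: le_trans)
    then show ?thesis using win_done[of "stage_goal n H (2 * k + 2) f"] by blast
  next
    case True
    then obtain a0 where a0: "a0 \<in> A1" "Inv n a0 \<le> H" by blast
    then have "inj_on a0 {..<n}" using A A1 by blast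
    then obtain y where y: "bij_betw y {..<n} {..<n}" "\<And>p q. p < q \<Longrightarrow> q < n \<Longrightarrow> a0 (y p) < a0 (y q)"
      using strict_enumeration[of "{..<n}" a0 n] by auto
    have inj: "inj_on y {..<n}" and img: "y ` {..<n} = {..<n}" using y(1) by (auto simp: bij_betw_def)
    have yn: "y p < n" if "p < n" for p using img that by auto
    define P where "P = (\<lambda>p. (y p, y (Suc p))) ` {p. Suc p < n}"
    have finP: "finite {p. Suc p < n}" by (rule finite_subset[of _ "{..<n}"]) auto
    have y_eq: "p = p'" if "y p = y p'" "p < n" "p' < n" for p p'
      using inj_onD[OF inj that(1)] that by simp
    have P_less: "fst e < n" "snd e < n" if e: "e \<in> P" for e
    proof -
      obtain p where "Suc p < n" "e = (y p, y (Suc p))" using e unfolding P_def by blast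
      then show "fst e < n" "snd e < n" using yn[of p] yn[of "Suc p"] by simp_all
    qed
    have deg: "card {e \<in> P. fst e = x \<or> snd e = x} \<le> 2" for x
    proof (cases "x < n")
      case True
      then obtain p where p: "p < n" "y p = x" using img by (metis imageE lessThan_iff)
      have "{e \<in> P. fst e = x \<or> snd e = x} \<subseteq> {(y p, y (Suc p)), (y (p - 1), y p)}"
      proof
        fix e assume "e \<in> {e \<in> P. fst e = x \<or> snd e = x}"
        then obtain r where r: "Suc r < n" "e = (y r, y (Suc r))" "y r = x \<or> y (Suc r) = x"
          by (auto simp: P_def)
        then have "r = p \<or> Suc r = p" using p y_eq[of r p] y_eq[of "Suc r" p] by auto
        then show "e \<in> {(y p, y (Suc p)), (y (p - 1), y p)}" using r(2) by auto
      qed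
      then have "card {e \<in> P. fst e = x \<or> snd e = x} \<le> card {(y p, y (Suc p)), (y (p - 1), y p)}"
        by (intro card_mono) auto
      also have "\<dots> \<le> 2" by (simp add: card_insert_if)
      finally show ?thesis .
    next
      case False
      then have empty: "{e \<in> P. fst e = x \<or> snd e = x} = {}" using P_less by blast
      show ?thesis by (simp only: empty card.empty le0)
    qed
    have "win n (\<lambda>A' f'. (\<forall>(x, y)\<in>P. decided A' x y) \<and>
       (\<forall>x. f' x = f1 x + card {e \<in> P. fst e = x \<or> snd e = x})) A1 f1"
    proof (rule win_compare_pairs)
      show "finite P" using finP by (simp add: P_def)
      fix u v assume "(u, v) \<in> P"
      then obtain p where p: "Suc p < n" "u = y p" "v = y (Suc p)" by (auto simp: P_def)
      then show "u < n \<and> v < n \<and> u \<noteq> v" using yn[of p] yn[of "Suc p"] y_eq[of p "Suc p"] by auto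
    qed
    then show ?thesis
    proof (rule win_mono, elim conjE)
      fix A2 f2
      assume A2: "A2 \<subseteq> A1" "A2 \<noteq> {}" and dec: "\<forall>(x, y)\<in>P. decided A2 x y"
        and f2: "\<forall>x. f2 x = f1 x + card {e \<in> P. fst e = x \<or> snd e = x}"
      have dec: "decided A2 (y p) (y (Suc p))" if "Suc p < n" for p
        using dec that by (auto simp: P_def)
      have "(\<exists>xs. distinct xs \<and> set xs = {..<n} \<and> (\<forall>a\<in>A2. sorted (map a xs))) \<or> (\<forall>a\<in>A2. H < Inv n a)"
      proof (cases "\<exists>a\<in>A2. Inv n a \<le> H")
        case True
        then obtain a1 where a1: "a1 \<in> A2" "Inv n a1 \<le> H" by blast
        have adj: "a (y p) < a (y (Suc p))" if "a \<in> A2" "Suc p < n" for a p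
        proof -
          have "a0 (y p) < a0 (y (Suc p))" using y(2)[of p "Suc p"] that(2) by simp
          then have "a1 (y p) < a1 (y (Suc p))"
            using agree[rule_format, OF a0(1) subsetD[OF A2(1) a1(1)] a0(2) a1(2) yn yn] that(2) by simp
          then have "before A2 (y p) (y (Suc p))"
            using decided_cases_at[OF dec[OF that(2)] a1(1)] by blast
          then show ?thesis using that(1) by (simp add: before_def)
        qed
        let ?xs = "map y [0..<n]"
        have "distinct ?xs" using inj by (simp add: distinct_map atLeast0LessThan)
        moreover have "set ?xs = {..<n}" using img by (simp add: atLeast0LessThan)
        moreover have "sorted (map a ?xs)" if "a \<in> A2" for a
          by (rule sorted_iff_nth_Suc[THEN iffD2]) (use adj[OF that] in \<open>auto simp: less_imp_le\<close>)
        ultimately show ?thesis by blast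
      qed (auto simp: not_le)
      moreover have "f2 x \<le> f x + (2 * k + 2)" for x
        using spec[OF f1, of x] spec[OF f2, of x] deg[of x] by simp
      ultimately show "stage_goal n H (2 * k + 2) f A2 f2" unfolding stage_goal_def by blast
    qed
  qed
qed

text \<open>The counts belong to the position, so they have to meet the bound of every input still
  consistent with it.\<close>

definition done_goal :: "nat \<Rightarrow> real \<Rightarrow> (nat \<Rightarrow> nat) set \<Rightarrow> (nat \<Rightarrow> nat) \<Rightarrow> bool" where
  "done_goal n c A' f' \<longleftrightarrow> (\<exists>xs. distinct xs \<and> set xs = {..<n} \<and> (\<forall>a\<in>A'. sorted (map a xs))) \<and>
     (\<forall>a\<in>A'. \<forall>x. real (f' x) \<le> c * lg (Inv n a))"

lemma le_lg: "2 ^ m \<le> r \<Longrightarrow> real m \<le> lg r"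
  unfolding lg_def
proof -
  assume "2 ^ m \<le> r"
  then have "2 ^ m \<le> max r 2" by simp
  then have "real (2 ^ m) \<le> real (max r 2)" by (rule of_nat_mono)
  then have "2 powr real m \<le> real (max r 2)" by (simp add: powr_realpow)
  then show "real m \<le> log 2 (real (max r 2))" by (subst le_log_iff) auto
qed

lemma one_le_lg: "1 \<le> lg r"
  unfolding lg_def by (subst le_log_iff) auto

text \<open>Before stage \<open>i\<close> at most \<open>K * (2 ^ i - 1)\<close> is spent per
  element. If stage \<open>i > 0\<close> succeeds, the failure of the previous guess gives
  \<open>2 ^ (i - 1) \<le> lg (Inv n a)\<close>, and the total is below
  \<open>K * 2 ^ Suc i\<close>, which is \<open>4 * K\<close> times
  \<open>2 ^ (i - 1)\<close>.\<close>

lemma win_adaptive_from: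
  assumes q: "\<And>t S A f. S \<subseteq> {..<n} \<Longrightarrow> card S \<le> 2 ^ t \<Longrightarrow> win n (sort_goal (q * t) S f) A f"
    and A: "\<And>a. a \<in> A \<Longrightarrow> inj_on a {..<n}" and K: "K = 6 * q + 2"
    and f: "\<And>x. f x + K \<le> K * 2 ^ i" and Inv: "\<And>a. a \<in> A \<Longrightarrow> i = 0 \<or> 2 ^ 2 ^ (i - 1) < Inv n a"
    and d: "i + d = Suc (n * n)"
  shows "win n (done_goal n (real (4 * K))) A f"
  using A f Inv d
proof (induction d arbitrary: i A f)
  case 0
  \<comment> \<open>The guess has outgrown \<open>n * n\<close>, the trivial bound on the number of
    inversions.\<close>
  have "A = {}"
  proof (rule ccontr)
    assume "A \<noteq> {}"
    then obtain a where "a \<in> A" by blast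
    then have "2 ^ 2 ^ (n * n) < Inv n a" using 0(3)[of a] 0(4) by simp
    also have "\<dots> \<le> n * n" by (rule Inv_le)
    also have "\<dots> < 2 ^ (n * n)" by (rule less_exp)
    also have "\<dots> < 2 ^ 2 ^ (n * n)" using less_exp[of "n * n"] by (rule power_strict_increasing) simp
    finally show False .
  qed
  then show ?case by (simp add: win_empty)
next
  case (Suc d)
  \<comment> \<open>\<open>2 ^ ?t\<close> is \<open>4 * ?H\<close>, and \<open>K\<close> is such
    that the stage costs at most \<open>K * 2 ^ i\<close>.\<close>
  let ?H = "2 ^ 2 ^ i :: nat" and ?t = "2 ^ i + 2 :: nat"
  have "win n (stage_goal n ?H (2 * (q * ?t) + 2) f) A f"
  proof (rule win_stage[OF q])
    show "4 * ?H \<le> 2 ^ ?t" by (simp add: power_add)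
  qed (use Suc.prems(1) in simp_all)
  then show ?case
  proof (rule win_bind, unfold stage_goal_def, elim conjE)
    fix A' f'
    assume A': "A' \<subseteq> A"
      and alt: "(\<exists>xs. distinct xs \<and> set xs = {..<n} \<and> (\<forall>a\<in>A'. sorted (map a xs))) \<or> (\<forall>a\<in>A'. ?H < Inv n a)"
      and f': "\<forall>x. f' x \<le> f x + (2 * (q * ?t) + 2)"
    have cost: "f' x + K \<le> K * 2 ^ Suc i" for x
    proof -
      have "q \<le> q * 2 ^ i" "(1::nat) \<le> 2 ^ i" by simp_all
      moreover have "q * ?t = q * 2 ^ i + 2 * q" "K * 2 ^ i = 6 * (q * 2 ^ i) + 2 * 2 ^ i"
        by (simp_all add: K algebra_simps)
      ultimately have "2 * (q * ?t) + 2 \<le> K * 2 ^ i" by linarith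
      then show ?thesis using spec[OF f', of x] Suc.prems(2)[of x] by simp
    qed
    show "win n (done_goal n (real (4 * K))) A' f'"
    proof (cases "\<forall>a\<in>A'. ?H < Inv n a")
      case True
      show ?thesis
        by (rule Suc.IH[of A' f' "Suc i"]) (use True cost Suc.prems(1,4) A' in auto)
    next
      case False
      have "real (f' x) \<le> real (4 * K) * lg (Inv n a)" if a: "a \<in> A'" for a x
      proof (cases i)
        case 0
        have "f' x \<le> 4 * K" using cost[of x] 0 by simp
        then have "real (f' x) \<le> real (4 * K) * 1" by (simp only: mult_1_right of_nat_le_iff)
        also have "\<dots> \<le> real (4 * K) * lg (Inv n a)" by (intro mult_left_mono one_le_lg) simp
        finally show ?thesis .
      next
        case (Suc i')
        have "f' x \<le> (4 * K) * 2 ^ i'" using cost[of x] Suc by simp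
        then have "real (f' x) \<le> real ((4 * K) * 2 ^ i')" by (rule of_nat_mono)
        also have "\<dots> = real (4 * K) * real (2 ^ i')" by simp
        also have "\<dots> \<le> real (4 * K) * lg (Inv n a)"
          using Suc.prems(3)[of a] a A' Suc by (intro mult_left_mono le_lg) auto
        finally show ?thesis .
      qed
      then have "done_goal n (real (4 * K)) A' f'" unfolding done_goal_def using alt False by blast
      then show ?thesis using win_done[of "done_goal n (real (4 * K))"] by blast
    qed
  qed
qed

lemma adaptive_upper_bound:
  "\<exists>(c::real) (T :: nat \<Rightarrow> dtree). (\<forall>n. sorts n (T n)) \<and>
     (\<forall>n a. inj_on a {..<n} \<longrightarrow> (\<forall>i<n. real (participations (T n) a i) \<le> c * lg (Inv n a)))"
proof -
  obtain q where q: "\<And>n t S A f. S \<subseteq> {..<n} \<Longrightarrow> card S \<le> 2 ^ t \<Longrightarrow> win n (sort_goal (q * t) S f) A f"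
    using win_sort by metis
  define c where "c = real (4 * (6 * q + 2))"
  define out where "out n A' f' = (SOME xs. distinct xs \<and> set xs = {..<n} \<and> (\<forall>a\<in>A'. sorted (map a xs)))"
    for n and A' :: "(nat \<Rightarrow> nat) set" and f' :: "nat \<Rightarrow> nat"
  have "\<exists>T. sorts n T \<and> (\<forall>a. inj_on a {..<n} \<longrightarrow> (\<forall>i<n. real (participations T a i) \<le> c * lg (Inv n a)))" for n
  proof -
    let ?A = "{a. inj_on a {..<n}}"
    have W: "win n (done_goal n c) ?A (\<lambda>_. 0)"
      unfolding c_def by (rule win_adaptive_from[OF q, where i = 0 and d = "Suc (n * n)"]) auto
    have "\<exists>T. indices_ok n T \<and> (\<forall>a\<in>?A. \<exists>A' f'. done_goal n c A' f' \<and> a \<in> A' \<and>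
           run T a = out n A' f' \<and> (\<forall>x. f' x = 0 + participations T a x))"
      by (rule win_imp_dtree[OF W]) simp
    then obtain T where T: "indices_ok n T" "\<forall>a\<in>?A. \<exists>A' f'. done_goal n c A' f' \<and> a \<in> A' \<and>
           run T a = out n A' f' \<and> (\<forall>x. f' x = 0 + participations T a x)" by blast
    have "distinct (run T a) \<and> set (run T a) = {..<n} \<and> sorted (map a (run T a)) \<and>
        (\<forall>x. real (participations T a x) \<le> c * lg (Inv n a))" if a: "inj_on a {..<n}" for a
    proof -
      obtain A' f' where D: "done_goal n c A' f'" "a \<in> A'" "run T a = out n A' f'"
        "\<And>x. f' x = participations T a x" using bspec[OF T(2), of a] a by auto
      let ?P = "\<lambda>xs. distinct xs \<and> set xs = {..<n} \<and> (\<forall>a\<in>A'. sorted (map a xs))"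
      have "\<exists>xs. ?P xs" using D(1) by (simp add: done_goal_def)
      then have "?P (run T a)" unfolding D(3) out_def by (rule someI_ex)
      moreover have "real (f' x) \<le> c * lg (Inv n a)" for x using D(1,2) by (simp add: done_goal_def)
      ultimately show ?thesis using D(2,4) by simp
    qed
    then show ?thesis using T(1) by (auto simp: sorts_def)
  qed
  then obtain T where "\<And>n. sorts n (T n) \<and>
      (\<forall>a. inj_on a {..<n} \<longrightarrow> (\<forall>i<n. real (participations (T n) a i) \<le> c * lg (Inv n a)))" by metis
  then show ?thesis by blast
qed

section \<open>The lower bound\<close>

text \<open>Element 0 is to be inserted at rank j into the increasing sequence of the others. Comparisons that
do not involve element 0 have the same answer for every j.\<close>

definition insertion_input :: "nat \<Rightarrow> nat \<Rightarrow> nat" where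
  "insertion_input j i = (if i = 0 then 2 * j else 2 * i - 1)"

text \<open>Parity: element 0 has an even value, all others have odd ones.\<close>

lemma inj_insertion_input: "inj (insertion_input j)"
proof (rule injI)
  fix x y assume "insertion_input j x = insertion_input j y"
  then show "x = y" unfolding insertion_input_def by (cases x; cases y) (auto, presburger+)
qed

lemma Inv_insertion_input:
  assumes "j < n"
  shows "Inv n (insertion_input j) \<le> j"
proof -
  have "{(u, v). u < v \<and> v < n \<and> insertion_input j u > insertion_input j v} \<subseteq> Pair 0 ` {1..j}"
    by (auto simp: insertion_input_def split: if_splits)
  then have "Inv n (insertion_input j) \<le> card (Pair (0::nat) ` {1..j})"
    unfolding Inv_def by (intro card_mono) auto
  also have "\<dots> = j" by (simp add: card_image inj_on_def)
  finally show ?thesis .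
qed

text \<open>An adversary argument: a comparison of element 0 divides \<open>J\<close>, and on the
  side with more outputs at least half of them survive while element 0 pays 1. Other comparisons
  leave \<open>J\<close> whole and cost element 0 nothing.\<close>

lemma few_outputs:
  assumes "finite J" "J \<noteq> {}"
  shows "\<exists>j\<in>J. card ((\<lambda>j. run T (insertion_input j)) ` J) \<le> 2 ^ participations T (insertion_input j) 0"
  using assms
proof (induction T arbitrary: J)
  case (Out xs)
  then show ?case by (auto simp: participations_def image_constant_conv)
next
  case (Cmp u v l r)
  let ?lt = "\<lambda>j. insertion_input j u < insertion_input j v"
  show ?case
  proof (cases "u = 0 \<or> v = 0")
    case False
    then have same: "?lt j \<longleftrightarrow> u < v" for j by (auto simp: insertion_input_def)
    show ?thesis
      using Cmp.IH(1)[OF Cmp.prems] Cmp.IH(2)[OF Cmp.prems] False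
      by (cases "u < v") (simp_all add: same participations_def)
  next
    case True
    let ?J1 = "{j \<in> J. ?lt j}" and ?J2 = "{j \<in> J. \<not> ?lt j}"
    let ?r = "\<lambda>T J. (\<lambda>j. run T (insertion_input j)) ` J"
    have fin: "finite ?J1" "finite ?J2" using Cmp.prems(1) by auto
    have "?J1 \<union> ?J2 = J" by blast
    then have "?r (Cmp u v l r) J = ?r (Cmp u v l r) ?J1 \<union> ?r (Cmp u v l r) ?J2"
      by (simp only: image_Un[symmetric])
    also have "?r (Cmp u v l r) ?J1 = ?r l ?J1" by (rule image_cong) simp_all
    also have "?r (Cmp u v l r) ?J2 = ?r r ?J2" by (rule image_cong) simp_all
    finally have le: "card (?r (Cmp u v l r) J) \<le> card (?r l ?J1) + card (?r r ?J2)"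
      by (simp only: card_Un_le)
    have pos: "0 < card (?r (Cmp u v l r) J)" using Cmp.prems by (simp add: card_gt_0_iff del: run.simps)
    have part: "participations (Cmp u v l r) (insertion_input j) 0 =
       Suc (participations (if ?lt j then l else r) (insertion_input j) 0)" for j
      using True by (auto simp: participations_def)
    show ?thesis
    proof (cases "card (?r r ?J2) \<le> card (?r l ?J1)")
      case True
      then have "card (?r l ?J1) \<noteq> 0" using le pos by linarith
      then have "?J1 \<noteq> {}" by (metis card.empty image_empty)
      then obtain j where j: "j \<in> J" "?lt j" "card (?r l ?J1) \<le> 2 ^ participations l (insertion_input j) 0"
        using Cmp.IH(1)[OF fin(1)] by blast
      have "card (?r (Cmp u v l r) J) \<le> 2 * 2 ^ participations l (insertion_input j) 0"
        using le True j(3) by linarith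
      then show ?thesis using j(1,2) part[of j] by (metis power_Suc)
    next
      case False
      then have "card (?r r ?J2) \<noteq> 0" by linarith
      then have "?J2 \<noteq> {}" by (metis card.empty image_empty)
      then obtain j where j: "j \<in> J" "\<not> ?lt j" "card (?r r ?J2) \<le> 2 ^ participations r (insertion_input j) 0"
        using Cmp.IH(2)[OF fin(2)] by blast
      have "card (?r (Cmp u v l r) J) \<le> 2 * 2 ^ participations r (insertion_input j) 0"
        using le False j(3) by linarith
      then show ?thesis using j(1,2) part[of j] by (metis power_Suc)
    qed
  qed
qed

text \<open>For the case \<open>k = 0\<close>, where counting gives nothing: a single output forces
  no comparison, but \<open>lg 0\<close> is 1.\<close>

lemma run_eq_if_no_participation:
  "participations T (insertion_input j) 0 = 0 \<Longrightarrow>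
   run T (insertion_input j') = run T (insertion_input j)"
proof (induction T)
  case (Cmp u v l r)
  then have "u \<noteq> 0" "v \<noteq> 0" by (auto simp: participations_def split: if_splits)
  then have "insertion_input j' u < insertion_input j' v \<longleftrightarrow> insertion_input j u < insertion_input j v"
    by (auto simp: insertion_input_def)
  then show ?case using Cmp by (auto simp: participations_def split: if_splits)
qed simp

lemma sorted_map_less_precedes:
  assumes "sorted (map a xs)" "p < length xs" "q < length xs" "a (xs ! p) < (a (xs ! q) :: nat)"
  shows "p < q"
proof (rule ccontr)
  assume "\<not> p < q"
  then have "map a xs ! q \<le> map a xs ! p" using assms by (intro sorted_nth_mono) auto
  then show False using assms by simp
qed

lemma insertion_outputs_differ:
  assumes T: "sorts n T" and j: "j < j'" "j' < n"
  shows "run T (insertion_input j) \<noteq> run T (insertion_input j')"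
proof
  assume eq: "run T (insertion_input j) = run T (insertion_input j')"
  let ?xs = "run T (insertion_input j)"
  have inj: "inj_on (insertion_input i) {..<n}" for i
    using inj_insertion_input by (rule inj_on_subset) simp
  have s: "set ?xs = {..<n}" "sorted (map (insertion_input j) ?xs)" "sorted (map (insertion_input j') ?xs)"
    using T inj eq unfolding sorts_def by metis+
  obtain p where p: "p < length ?xs" "?xs ! p = 0" using s(1) j by (metis in_set_conv_nth lessThan_iff less_nat_zero_code not_gr_zero)
  \<comment> \<open>Element \<open>j'\<close> tells the inputs apart: its value
    \<open>2 * j' - 1\<close> lies between \<open>2 * j\<close> and \<open>2 * j'\<close>, the two
    values of element 0.\<close>
  obtain p' where p': "p' < length ?xs" "?xs ! p' = j'" using s(1) j by (metis in_set_conv_nth lessThan_iff)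
  have "p < p'" by (rule sorted_map_less_precedes[OF s(2) p(1) p'(1)]) (use p p' j in \<open>auto simp: insertion_input_def\<close>)
  moreover have "p' < p" by (rule sorted_map_less_precedes[OF s(3) p'(1) p(1)]) (use p p' j in \<open>auto simp: insertion_input_def\<close>)
  ultimately show False by simp
qed

text \<open>For positive \<open>k\<close>, insertion into \<open>Suc k\<close> elements has
  \<open>Suc k\<close> different outputs, which is at least \<open>max k 2\<close>. For
  \<open>k = 0\<close> that would be a single element, so two elements are taken, with the input
  that is already sorted.\<close>

lemma lower_bound:
  "\<exists>n. \<forall>T. sorts n T \<longrightarrow> (\<exists>a. inj_on a {..<n} \<and> Inv n a \<le> k \<and>
     (\<exists>i<n. lg k \<le> real (participations T a i)))"
proof (cases "k = 0")
  case True
  show ?thesis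
  proof (intro exI[of _ 2] allI impI)
    fix T assume T: "sorts 2 T"
    have "participations T (insertion_input 0) 0 \<noteq> 0"
      using insertion_outputs_differ[OF T, of 0 1] run_eq_if_no_participation[of T 0 1] by auto
    then have "lg k \<le> real (participations T (insertion_input 0) 0)" using True by (simp add: lg_def)
    moreover have "Inv 2 (insertion_input 0) \<le> k" using Inv_insertion_input[of 0 2] by simp
    moreover have "inj_on (insertion_input 0) {..<2}"
      using inj_insertion_input by (rule inj_on_subset) simp
    ultimately show "\<exists>a. inj_on a {..<2} \<and> Inv 2 a \<le> k \<and>
       (\<exists>i<2. lg k \<le> real (participations T a i))" by (meson zero_less_numeral)
  qed
next
  case False
  show ?thesis
  proof (intro exI[of _ "Suc k"] allI impI)
    fix T assume T: "sorts (Suc k) T"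
    let ?r = "\<lambda>j. run T (insertion_input j)"
    have "inj_on ?r {..<Suc k}"
    proof (rule inj_onI, rule ccontr)
      fix i j assume ij: "i \<in> {..<Suc k}" "j \<in> {..<Suc k}" "?r i = ?r j" "i \<noteq> j"
      then show False
        using insertion_outputs_differ[OF T, of i j] insertion_outputs_differ[OF T, of j i]
        by (cases i j rule: linorder_cases) auto
    qed
    then have "card (?r ` {..<Suc k}) = Suc k" by (simp add: card_image)
    moreover obtain j where j: "j < Suc k"
      "card (?r ` {..<Suc k}) \<le> 2 ^ participations T (insertion_input j) 0"
      using few_outputs[of "{..<Suc k}" T] by (auto simp: lessThan_empty_iff)
    ultimately have "max k 2 \<le> 2 ^ participations T (insertion_input j) 0" using False by simp
    then have "real (max k 2) \<le> 2 ^ participations T (insertion_input j) 0"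
      by (metis of_nat_le_iff of_nat_numeral of_nat_power)
    then have "lg k \<le> real (participations T (insertion_input j) 0)"
      unfolding lg_def by (subst log_le_iff) (auto simp: powr_realpow)
    moreover have "Inv (Suc k) (insertion_input j) \<le> k"
      using Inv_insertion_input[OF j(1)] j(1) by simp
    moreover have "inj_on (insertion_input j) {..<Suc k}"
      using inj_insertion_input by (rule inj_on_subset) simp
    ultimately show "\<exists>a. inj_on a {..<Suc k} \<and> Inv (Suc k) a \<le> k \<and>
       (\<exists>i<Suc k. lg k \<le> real (participations T a i))" by blast
  qed
qed

theorem theorem10:
  shows "(\<exists>c::real. \<exists>T :: nat \<Rightarrow> dtree.
            (\<forall>n. sorts n (T n)) \<and>
            (\<forall>n a. inj_on a {..<n} \<longrightarrow>
               (\<forall>i<n. real (participations (T n) a i) \<le> c * lg (Inv n a))))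
       \<and> (\<exists>c::real. c > 0 \<and>
            (\<forall>k. \<exists>n. \<forall>T. sorts n T \<longrightarrow>
               (\<exists>a. inj_on a {..<n} \<and> Inv n a \<le> k \<and>
                  (\<exists>i<n. real (participations T a i) \<ge> c * lg k))))"
  by (intro conjI adaptive_upper_bound exI[of _ "1::real"] zero_less_one allI)
    (simp only: mult_1 lower_bound)

end
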